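(* Let $p\geq 3$ be a prime and $H_p$ the Heisenberg group over $\mathbb Z_p$ (presented as $\{x^ay^bz^c:0\le a,b,c<p\}$ with $x^p=y^p=z^p=1$, $xz=zx$, $yz=zy$, $yx=xyz$). For $F=\sum_{0\le i,j,k<p}a_{ijk}x^iy^jz^k$ with $a_{ijk}\in\mathbb Z$, if $p\mid M_{H_p}(F)$ then $p^{p^2+3}\mid M_{H_p}(F)$. Moreover, there exists such an $F$ with $p^{p^2+3}\parallel M_{H_p}(F)$.
   Context: $M_{H_p}(F)=\det(a_{gh^{-1}})_{g,h\in H_p}$ is the group determinant of $H_p$ evaluated at the coefficients of $F$, where $a_g=a_{ijk}$ for $g=x^iy^jz^k$. $p^e\parallel N$ means $p^e\mid N$ and $p^{e+1}\nmid N$. *)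

theory Defs
  imports
    "HOL-Algebra.Group"
    "HOL-Computational_Algebra.Primes"
    "Jordan_Normal_Form.Determinant"
begin

text \<open>
  The triple \<open>(a, b, c)\<close> with entries in \<open>{0..<p}\<close> stands for the normal form
  \<open>x\<^sup>a y\<^sup>b z\<^sup>c\<close>. From \<open>yx = xyz\<close> with \<open>z\<close> central one gets
  \<open>y\<^sup>b x\<^sup>a\<^sup>' = x\<^sup>a\<^sup>' y\<^sup>b z\<^sup>b\<^sup>a\<^sup>'\<close>, whence the term \<open>b * a'\<close> in the product.
\<close>

definition heisenberg :: "nat \<Rightarrow> (nat \<times> nat \<times> nat) monoid" where
  "heisenberg p = \<lparr>
     carrier = {0..<p} \<times> {0..<p} \<times> {0..<p},
     monoid.mult = (\<lambda>(a, b, c) (a', b', c').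
       ((a + a') mod p, (b + b') mod p, (c + c' + b * a') mod p)),
     one = (0, 0, 0)\<rparr>"

definition heis_x :: "nat \<times> nat \<times> nat" where "heis_x = (1, 0, 0)"
definition heis_y :: "nat \<times> nat \<times> nat" where "heis_y = (0, 1, 0)"
definition heis_z :: "nat \<times> nat \<times> nat" where "heis_z = (0, 0, 1)"

definition group_matrix ::
    "('g, 'm) monoid_scheme \<Rightarrow> 'g list \<Rightarrow> ('g \<Rightarrow> 'a) \<Rightarrow> 'a mat" where
  "group_matrix G xs a =
     mat (length xs) (length xs) (\<lambda>(i, j). a (xs ! i \<otimes>\<^bsub>G\<^esub> inv\<^bsub>G\<^esub> (xs ! j)))"

text \<open>
  Matrices are indexed by numbers, so the elements of the (finite) group are listed in an
  arbitrary order; \<open>group_det_eq\<close> below shows that the order is irrelevant.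
\<close>

definition group_det ::
    "('g, 'm) monoid_scheme \<Rightarrow> ('g \<Rightarrow> 'a :: comm_ring_1) \<Rightarrow> 'a" where
  "group_det G a =
     det (group_matrix G (SOME xs. distinct xs \<and> set xs = carrier G) a)"

definition heis_det :: "nat \<Rightarrow> (nat \<Rightarrow> nat \<Rightarrow> nat \<Rightarrow> int) \<Rightarrow> int" where
  "heis_det p a = group_det (heisenberg p) (\<lambda>(i, j, k). a i j k)"

definition exactly_divides :: "int \<Rightarrow> nat \<Rightarrow> int \<Rightarrow> bool" where
  "exactly_divides q e N \<longleftrightarrow> q ^ e dvd N \<and> \<not> q ^ (e + 1) dvd N"


lemma det_group_matrix_unique:
  fixes a :: "'g \<Rightarrow> 'a :: comm_ring_1"
  assumes "distinct xs" "distinct ys" "set xs = set ys"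
  shows "det (group_matrix G xs a) = det (group_matrix G ys a)"
proof -
  let ?n = "length xs"
  have "mset ys = mset xs"
    using assms set_eq_iff_mset_eq_distinct by metis
  then obtain f where f: "f permutes {..<?n}" "permute_list f xs = ys"
    using mset_eq_permutation by metis
  have f': "f permutes {0..<?n}"
    using f(1) by (simp add: atLeast0LessThan)
  have fn: "f i < ?n" if "i < ?n" for i
    using permutes_in_image[OF f(1), of i] that by simp
  have len: "length ys = ?n"
    using f(2) by auto
  have ys: "ys ! i = xs ! f i" if "i < ?n" for i
    using permute_list_nth[OF f(1) that] f(2) by simp
  define A where "A = group_matrix G xs a"
  define B where "B = mat ?n ?n (\<lambda>(i, j). A $$ (f i, j))"
  have A: "A \<in> carrier_mat ?n ?n"
    by (simp add: A_def group_matrix_def)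
  have B: "B \<in> carrier_mat ?n ?n"
    by (simp add: B_def)
  have sg: "(signof f :: 'a) * signof f = 1"
    by (simp add: sign_def)
  have eq: "group_matrix G ys a =
      transpose_mat (mat ?n ?n (\<lambda>(i, j). transpose_mat B $$ (f i, j)))"
    by (rule eq_matI) (auto simp: group_matrix_def len ys B_def A_def fn)
  have "det (group_matrix G ys a) = det (mat ?n ?n (\<lambda>(i, j). transpose_mat B $$ (f i, j)))"
    unfolding eq by (rule det_transpose[where n = ?n]) simp
  also have "\<dots> = signof f * det (transpose_mat B)"
    by (rule det_permute_rows[OF _ f']) (use B in simp)
  also have "det (transpose_mat B) = det B"
    by (rule det_transpose[OF B])
  also have "det B = signof f * det A"
    unfolding B_def by (rule det_permute_rows[OF A f'])
  finally show ?thesis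
    using sg by (simp add: A_def mult.assoc[symmetric])
qed

lemma group_det_eq:
  assumes "distinct xs" "set xs = carrier G"
  shows "group_det G a = det (group_matrix G xs a)"
proof -
  define ys where "ys = (SOME xs. distinct xs \<and> set xs = carrier G)"
  have "distinct ys \<and> set ys = carrier G"
    unfolding ys_def by (rule someI[of _ xs]) (use assms in simp)
  then show ?thesis
    unfolding group_det_def ys_def[symmetric]
    using assms by (intro det_group_matrix_unique) auto
qed

lemma group_heisenberg:
  assumes "p > 0"
  shows "group (heisenberg p)"
proof (rule groupI)
  fix u v w
  assume "u \<in> carrier (heisenberg p)" "v \<in> carrier (heisenberg p)" "w \<in> carrier (heisenberg p)"
  then show "u \<otimes>\<^bsub>heisenberg p\<^esub> v \<otimes>\<^bsub>heisenberg p\<^esub> w =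
      u \<otimes>\<^bsub>heisenberg p\<^esub> (v \<otimes>\<^bsub>heisenberg p\<^esub> w)"
  proof -
    have third: "((c + c' + b * a') mod p + c'' + (b + b') mod p * a'') mod p =
        (c + (c' + c'' + b' * a'') mod p + b * ((a' + a'') mod p)) mod p"
      for a' a'' b b' c c' c'' :: nat
    proof -
      have "((c + c' + b * a') mod p + c'' + (b + b') mod p * a'') mod p =
          ((c + c' + b * a') + c'' + (b + b') * a'') mod p"
        by (intro mod_add_cong mod_mult_cong) simp_all
      also have "(c + c' + b * a') + c'' + (b + b') * a'' =
          c + (c' + c'' + b' * a'') + b * (a' + a'')"
        by (simp add: algebra_simps)
      also have "\<dots> mod p = (c + (c' + c'' + b' * a'') mod p + b * ((a' + a'') mod p)) mod p"
        by (intro mod_add_cong mod_mult_cong) simp_all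
      finally show ?thesis .
    qed
    show ?thesis
      by (cases u; cases v; cases w) (simp add: heisenberg_def third; simp add: mod_simps add.assoc)
  qed
next
  fix u
  assume u: "u \<in> carrier (heisenberg p)"
  obtain a b c where abc: "u = (a, b, c)" by (cases u)
  define v where "v = ((p - a) mod p, (p - b) mod p, (p * p + b * a - c) mod p)"
  have le: "a < p" "b < p" "c < p"
    using u abc by (auto simp: heisenberg_def)
  have "v \<in> carrier (heisenberg p)"
    using assms by (simp add: v_def heisenberg_def)
  moreover have "v \<otimes>\<^bsub>heisenberg p\<^esub> u = \<one>\<^bsub>heisenberg p\<^esub>"
  proof -
    have "c \<le> p * p"
      using le assms by (metis less_imp_le le_square order_trans)
    then have "(p * p + b * a - c) + c + (p - b) * a = p * p + p * a"
      using le by (simp add: diff_mult_distrib)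
    then have "((p * p + b * a - c) + c + (p - b) * a) mod p = 0"
      by simp
    moreover have "((p * p + b * a - c) mod p + c + ((p - b) mod p) * a) mod p =
        ((p * p + b * a - c) + c + (p - b) * a) mod p"
      by (intro mod_add_cong mod_mult_cong) simp_all
    ultimately have "((p * p + b * a - c) mod p + c + ((p - b) mod p) * a) mod p = 0"
      by simp
    moreover have "((p - a) mod p + a) mod p = 0" "((p - b) mod p + b) mod p = 0"
      using le by (simp_all add: mod_simps)
    ultimately show ?thesis
      by (simp add: v_def abc heisenberg_def)
  qed
  ultimately show "\<exists>v\<in>carrier (heisenberg p). v \<otimes>\<^bsub>heisenberg p\<^esub> u = \<one>\<^bsub>heisenberg p\<^esub>"
    by blast
qed (use assms in \<open>auto simp: heisenberg_def\<close>)

lemma heisenberg_pow_x: "heis_x [^]\<^bsub>heisenberg p\<^esub> n = (n mod p, 0, 0)"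
  and heisenberg_pow_y: "heis_y [^]\<^bsub>heisenberg p\<^esub> n = (0, n mod p, 0)"
  and heisenberg_pow_z: "heis_z [^]\<^bsub>heisenberg p\<^esub> n = (0, 0, n mod p)"
  for n :: nat
  by (induction n;
      simp add: nat_pow_def heisenberg_def heis_x_def heis_y_def heis_z_def mod_simps)+

lemma heisenberg_normal_form:
  assumes "a < p" "b < p" "c < p"
  shows "heis_x [^]\<^bsub>heisenberg p\<^esub> a \<otimes>\<^bsub>heisenberg p\<^esub> heis_y [^]\<^bsub>heisenberg p\<^esub> b
           \<otimes>\<^bsub>heisenberg p\<^esub> heis_z [^]\<^bsub>heisenberg p\<^esub> c = (a, b, c)"
  unfolding heisenberg_pow_x heisenberg_pow_y heisenberg_pow_z
  using assms by (simp add: heisenberg_def)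

lemma heisenberg_relations:
  fixes p :: nat
  assumes "p > 1"
  defines "H \<equiv> heisenberg p"
  shows "heis_x [^]\<^bsub>H\<^esub> p = \<one>\<^bsub>H\<^esub>" "heis_y [^]\<^bsub>H\<^esub> p = \<one>\<^bsub>H\<^esub>" "heis_z [^]\<^bsub>H\<^esub> p = \<one>\<^bsub>H\<^esub>"
    and "heis_x \<otimes>\<^bsub>H\<^esub> heis_z = heis_z \<otimes>\<^bsub>H\<^esub> heis_x"
    and "heis_y \<otimes>\<^bsub>H\<^esub> heis_z = heis_z \<otimes>\<^bsub>H\<^esub> heis_y"
    and "heis_y \<otimes>\<^bsub>H\<^esub> heis_x = heis_x \<otimes>\<^bsub>H\<^esub> heis_y \<otimes>\<^bsub>H\<^esub> heis_z"
  unfolding H_def heisenberg_pow_x heisenberg_pow_y heisenberg_pow_z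
  using assms(1)
  by (simp_all add: heisenberg_def heis_x_def heis_y_def heis_z_def)

end

theory Submission
  imports
    Defs
    "HOL-Number_Theory.Residues"
    "Jordan_Normal_Form.Char_Poly"
begin

text \<open>
  Let \<open>\<omega>\<close> be a primitive \<open>p\<close>-th root of unity and \<open>\<pi> = \<omega> - 1\<close>, so that \<open>\<pi>\<^bsup>p-1\<^esup>\<close> is \<open>p\<close> times an
  element congruent to \<open>-1\<close> modulo \<open>\<pi>\<close> in \<open>\<int>[\<omega>]\<close>. A partial Fourier transform splits the group
  matrix into \<open>p\<^sup>2\<close> blocks of size \<open>p\<close>, indexed by \<open>s, u < p\<close>. Every block determinant is congruent to
  \<open>F(1,1,1)\<close> modulo \<open>p\<close>: expanding it along all rows, the terms fall into orbits under cyclic shifts,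
  the orbits of length \<open>p\<close> sum to multiples of \<open>p\<close>, and the fixed terms give \<open>\<Sum>a\<^bsup>p\<^esup>\<close>. If \<open>p\<close> divides
  the determinant, then it divides \<open>F(1,1,1)\<close> and hence each of the \<open>p(p-1)\<close> blocks with \<open>s > 0\<close>.

  The blocks with \<open>s = 0\<close> are circulant, with product \<open>\<Prod> F(\<omega>\<^bsup>u\<^esup>, \<omega>\<^bsup>v\<^esup>, 1)\<close>. The factor at \<open>(0,0)\<close> is
  divisible by \<open>p\<close>, the \<open>p\<^sup>2-1\<close> others by \<open>\<pi>\<close>, and since \<open>F(\<omega>\<^bsup>u\<^esup>, \<omega>\<^bsup>v\<^esup>, 1)\<close> is
  \<open>F(1,1,1) + (u\<alpha> + v\<beta>)\<pi>\<close> modulo \<open>\<pi>\<^sup>2\<close>, at least \<open>p-1\<close> of them are divisible by \<open>\<pi>\<^sup>2\<close>. Together this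
  is \<open>p \<cdot> \<pi>\<^bsup>(p-1)(p+2)\<^esup> \<cdot> p\<^bsup>p(p-1)\<^esup>\<close>, that is, \<open>p\<^bsup>p*p+3\<^esup>\<close>.

  Equality holds for \<open>F = y - h(x)\<close> with \<open>h(x) = 1 + (x-1)\<^sup>2 + t(1 + x + \<dots> + x\<^bsup>p-1\<^esup>)\<close>: the blocks with
  \<open>s > 0\<close> have determinant \<open>1 - \<Prod> h(\<omega>\<^bsup>i\<^esup>)\<close>, and \<open>t\<close> is chosen in \<open>{1, 2}\<close> so that this number and
  \<open>F(1,1,1) = -tp\<close> are exactly divisible by \<open>p\<close>.
\<close>

section \<open>Determinants indexed by lists\<close>

text \<open>Indexing by list entries instead of numbers lets rows be labelled by residues, group
  elements or character triples, so that a change of labels is just another list.\<close>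

definition ldet :: "'i list \<Rightarrow> ('i \<Rightarrow> 'i \<Rightarrow> 'a :: comm_ring_1) \<Rightarrow> 'a" where
  "ldet xs A = det (mat (length xs) (length xs) (\<lambda>(i, j). A (xs ! i) (xs ! j)))"

lemma ldet_map: "ldet (map f xs) A = ldet xs (\<lambda>i j. A (f i) (f j))"
  unfolding ldet_def by (intro arg_cong[where f = det] eq_matI) auto

lemma ldet_cong:
  assumes "xs = ys" and "\<And>i j. i \<in> set xs \<Longrightarrow> j \<in> set xs \<Longrightarrow> A i j = B i j"
  shows "ldet xs A = ldet ys B"
  unfolding ldet_def assms(1)[symmetric]
  by (intro arg_cong[where f = det] eq_matI) (auto simp: assms)

lemma ldet_of_int: "ldet xs (\<lambda>i j. of_int (A i j)) = of_int (ldet xs A)"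
  unfolding ldet_def of_int_hom.hom_det[symmetric]
  by (intro arg_cong[where f = det] eq_matI) auto

lemma sum_nth_distinct:
  assumes "distinct xs"
  shows "(\<Sum>k = 0..<length xs. f (xs ! k)) = (\<Sum>x\<in>set xs. f x)"
  using sum.reindex_bij_betw[OF bij_betw_nth[OF assms refl refl], of f] by (simp add: atLeast0LessThan)

lemma prod_nth_distinct:
  assumes "distinct xs"
  shows "(\<Prod>k = 0..<length xs. f (xs ! k)) = (\<Prod>x\<in>set xs. f x)"
  using prod.reindex_bij_betw[OF bij_betw_nth[OF assms refl refl], of f] by (simp add: atLeast0LessThan)

lemma ldet_mult:
  assumes "distinct xs"
  shows "ldet xs (\<lambda>i j. \<Sum>k\<in>set xs. A i k * B k j) = ldet xs A * ldet xs B"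
proof -
  let ?n = "length xs"
  have "mat ?n ?n (\<lambda>(i, j). \<Sum>k\<in>set xs. A (xs ! i) k * B k (xs ! j)) =
      mat ?n ?n (\<lambda>(i, j). A (xs ! i) (xs ! j)) * mat ?n ?n (\<lambda>(i, j). B (xs ! i) (xs ! j))"
    by (rule eq_matI) (auto simp: scalar_prod_def sum_nth_distinct[OF assms, symmetric])
  then show ?thesis
    unfolding ldet_def by (simp add: det_mult[of _ ?n])
qed

lemma ldet_diag:
  assumes "distinct xs"
  shows "ldet xs (\<lambda>i j. if i = j then d i else 0) = (\<Prod>x\<in>set xs. d x)"
proof -
  let ?n = "length xs"
  let ?M = "mat ?n ?n (\<lambda>(i, j). if xs ! i = xs ! j then d (xs ! i) else 0)"
  have "det ?M = prod_list (diag_mat ?M)"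
    by (rule det_upper_triangular[of _ ?n]) (use assms in \<open>auto simp: nth_eq_iff_index_eq\<close>)
  also have "\<dots> = (\<Prod>k = 0..<?n. d (xs ! k))"
    unfolding prod_list_diag_prod by (rule prod.cong) auto
  finally show ?thesis
    by (simp add: ldet_def prod_nth_distinct[OF assms])
qed

text \<open>From AP = PB follows det A * det P = det P * det B. The matrix Q certifies that det P is
  nonzero, which suffices to cancel in an integral domain, so no inverse of a Fourier matrix has to
  be formed.\<close>

lemma ldet_similar:
  fixes A B P Q :: "'i \<Rightarrow> 'i \<Rightarrow> 'a :: idom"
  assumes xs: "distinct xs"
    and AP: "\<And>i j. i \<in> set xs \<Longrightarrow> j \<in> set xs \<Longrightarrow>
      (\<Sum>k\<in>set xs. A i k * P k j) = (\<Sum>k\<in>set xs. P i k * B k j)"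
    and PQ: "\<And>i j. i \<in> set xs \<Longrightarrow> j \<in> set xs \<Longrightarrow>
      (\<Sum>k\<in>set xs. P i k * Q k j) = (if i = j then c else 0)"
    and "c \<noteq> 0"
  shows "ldet xs A = ldet xs B"
proof -
  have "ldet xs P * ldet xs Q = ldet xs (\<lambda>i j. if i = j then c else 0)"
    unfolding ldet_mult[OF xs, symmetric] by (rule ldet_cong) (simp_all add: PQ)
  then have "ldet xs P \<noteq> 0"
    using \<open>c \<noteq> 0\<close> by (auto simp: ldet_diag[OF xs])
  moreover have "ldet xs A * ldet xs P = ldet xs P * ldet xs B"
    unfolding ldet_mult[OF xs, symmetric] by (rule ldet_cong) (simp_all add: AP)
  ultimately show ?thesis
    by simp
qed

lemma ldet_append:
  fixes A :: "'i \<Rightarrow> 'i \<Rightarrow> 'a :: idom"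
  assumes "\<And>x y. x \<in> set xs \<Longrightarrow> y \<in> set ys \<Longrightarrow> A x y = 0"
  shows "ldet (xs @ ys) A = ldet xs A * ldet ys A"
proof -
  let ?n = "length xs" and ?m = "length ys"
  have "mat (?n + ?m) (?n + ?m) (\<lambda>(i, j). A ((xs @ ys) ! i) ((xs @ ys) ! j)) =
      four_block_mat (mat ?n ?n (\<lambda>(i, j). A (xs ! i) (xs ! j))) (0\<^sub>m ?n ?m)
        (mat ?m ?n (\<lambda>(i, j). A (ys ! i) (xs ! j))) (mat ?m ?m (\<lambda>(i, j). A (ys ! i) (ys ! j)))"
    by (rule eq_matI) (auto simp: nth_append assms)
  then show ?thesis
    unfolding ldet_def by (simp add: det_four_block_mat_upper_right_zero[of _ ?n _ ?m])
qed

lemma ldet_concat: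
  fixes A :: "'i \<Rightarrow> 'i \<Rightarrow> 'a :: idom"
  assumes "distinct zs"
    and "\<And>z z' x y. z \<in> set zs \<Longrightarrow> z' \<in> set zs \<Longrightarrow> z \<noteq> z' \<Longrightarrow>
      x \<in> set (f z) \<Longrightarrow> y \<in> set (f z') \<Longrightarrow> A x y = 0"
  shows "ldet (concat (map f zs)) A = (\<Prod>z\<in>set zs. ldet (f z) A)"
  using assms
proof (induction zs)
  case Nil
  then show ?case by (simp add: ldet_def)
next
  case (Cons z zs)
  have "ldet (f z @ concat (map f zs)) A = ldet (f z) A * ldet (concat (map f zs)) A"
    by (rule ldet_append) (use Cons.prems in auto)
  moreover have "ldet (concat (map f zs)) A = (\<Prod>z\<in>set zs. ldet (f z) A)"
    by (rule Cons.IH) (use Cons.prems in auto)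
  ultimately show ?case
    using Cons.prems by simp
qed

text \<open>Rows and columns are permuted alike, so the sign occurs twice and cancels.\<close>

lemma ldet_perm:
  assumes "distinct xs" "distinct ys" "set xs = set ys"
  shows "ldet xs A = ldet ys A"
proof -
  let ?n = "length xs"
  have "mset ys = mset xs"
    using assms set_eq_iff_mset_eq_distinct by metis
  then obtain f where f: "f permutes {..<?n}" "permute_list f xs = ys"
    using mset_eq_permutation by metis
  have f': "f permutes {0..<?n}"
    using f(1) by (simp add: atLeast0LessThan)
  have fn: "f i < ?n" if "i < ?n" for i
    using permutes_in_image[OF f(1), of i] that by simp
  have len: "length ys = ?n"
    using f(2) by auto
  have ys: "ys ! i = xs ! f i" if "i < ?n" for i
    using permute_list_nth[OF f(1) that] f(2) by simp
  define M where "M = mat ?n ?n (\<lambda>(i, j). A (xs ! i) (xs ! j))"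
  define N where "N = mat ?n ?n (\<lambda>(i, j). M $$ (f i, j))"
  have M: "M \<in> carrier_mat ?n ?n" and N: "N \<in> carrier_mat ?n ?n"
    by (simp_all add: M_def N_def)
  have eq: "mat ?n ?n (\<lambda>(i, j). A (ys ! i) (ys ! j)) =
      transpose_mat (mat ?n ?n (\<lambda>(i, j). transpose_mat N $$ (f i, j)))"
    by (rule eq_matI) (auto simp: ys N_def M_def fn)
  have "ldet ys A = det (mat ?n ?n (\<lambda>(i, j). transpose_mat N $$ (f i, j)))"
    unfolding ldet_def len eq by (rule det_transpose[where n = ?n]) simp
  also have "\<dots> = signof f * det (transpose_mat N)"
    by (rule det_permute_rows[OF _ f']) (use N in simp)
  also have "det (transpose_mat N) = signof f * det M"
    unfolding det_transpose[OF N] by (subst N_def, rule det_permute_rows[OF M f'])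
  finally show ?thesis
    by (simp add: ldet_def M_def mult.assoc[symmetric] sign_def)
qed

text \<open>Multilinearity in the rows: \<open>G\<close> picks one summand in each row.\<close>

lemma ldet_row_sums:
  fixes A :: "nat \<Rightarrow> 'k \<Rightarrow> nat \<Rightarrow> 'a :: comm_ring_1"
  assumes "finite K"
  shows "ldet [0..<n] (\<lambda>i j. \<Sum>k\<in>K. c i k * A i k j) =
    (\<Sum>G\<in>{..<n} \<rightarrow>\<^sub>E K. (\<Prod>i<n. c i (G i)) * ldet [0..<n] (\<lambda>i j. A i (G i) j))"
proof -
  let ?S = "{\<sigma>. \<sigma> permutes {0..<n}}"
  have lt: "\<sigma> i < n" if "\<sigma> permutes {0..<n}" "i < n" for \<sigma> i
    using permutes_in_image[OF that(1), of i] that(2) by simp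
  have ld: "ldet [0..<n] B = (\<Sum>\<sigma>\<in>?S. signof \<sigma> * (\<Prod>i<n. B i (\<sigma> i)))" for B :: "nat \<Rightarrow> nat \<Rightarrow> 'a"
    unfolding ldet_def
    by (subst det_def'[of _ n])
      (auto simp: atLeast0LessThan lt intro!: sum.cong arg_cong2[where f = "(*)"] prod.cong)
  have "ldet [0..<n] (\<lambda>i j. \<Sum>k\<in>K. c i k * A i k j) =
      (\<Sum>\<sigma>\<in>?S. signof \<sigma> * (\<Sum>G\<in>{..<n} \<rightarrow>\<^sub>E K. \<Prod>i<n. c i (G i) * A i (G i) (\<sigma> i)))"
    unfolding ld by (subst prod_sum_PiE) (use assms in auto)
  also have "\<dots> = (\<Sum>\<sigma>\<in>?S. \<Sum>G\<in>{..<n} \<rightarrow>\<^sub>E K.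
      (\<Prod>i<n. c i (G i)) * (signof \<sigma> * (\<Prod>i<n. A i (G i) (\<sigma> i))))"
    by (simp add: prod.distrib sum_distrib_left mult_ac)
  also have "\<dots> = (\<Sum>G\<in>{..<n} \<rightarrow>\<^sub>E K. (\<Prod>i<n. c i (G i)) * ldet [0..<n] (\<lambda>i j. A i (G i) j))"
    unfolding ld by (subst sum.swap) (simp add: sum_distrib_left)
  finally show ?thesis .
qed

lemma ldet_equal_rows:
  assumes "i < n" "i' < n" "i \<noteq> i'" and "\<And>j. j < n \<Longrightarrow> A i j = A i' j"
  shows "ldet [0..<n] A = 0"
  unfolding ldet_def
  by (rule det_identical_rows[of _ n i i']) (use assms in \<open>auto intro!: eq_vecI\<close>)

section \<open>Arithmetic in the ring generated by a root of unity\<close>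

lemma fermat_int:
  fixes a :: int
  assumes "prime p"
  shows "int p dvd a ^ p - a"
proof -
  define n where "n = nat (a mod int p)"
  have p0: "p > 0"
    using assms prime_gt_0_nat by blast
  have n: "int n = a mod int p"
    using p0 by (simp add: n_def)
  have "[n ^ p = n] (mod p)"
  proof (cases "p dvd n")
    case True
    then have "[n ^ p = 0] (mod p)" "[n = 0] (mod p)"
      using p0 by (simp_all add: cong_0_iff) (metis dvd_trans dvd_power)
    then show ?thesis
      using cong_sym cong_trans by blast
  next
    case False
    have "[n ^ (p - 1) * n = 1 * n] (mod p)"
      by (rule cong_scalar_right) (rule fermat_theorem[OF assms False])
    moreover have "n ^ (p - 1) * n = n ^ p"
      using p0 by (metis power_minus_mult)
    ultimately show ?thesis
      by simp
  qed
  then have "[int n ^ p = int n] (mod int p)"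
    by (metis cong_int_iff of_nat_power)
  moreover have "[a = int n] (mod int p)"
    by (simp add: n cong_def)
  ultimately have "[a ^ p = a] (mod int p)"
    by (meson cong_pow cong_sym cong_trans)
  then show ?thesis
    by (simp add: cong_iff_dvd_diff)
qed

locale prime_root =
  fixes p :: nat and w :: complex
  assumes prime_p: "prime p" and p3: "p \<ge> 3" and w_pow_p: "w ^ p = 1" and w_neq_1: "w \<noteq> 1"
begin

section \<open>Residues modulo p and powers of the root of unity\<close>

lemma p_pos: "p > 0"
  using p3 by simp

lemma odd_p: "odd p"
  using prime_odd_nat[OF prime_p] p3 by simp

lemma shift_mod: "i < p \<Longrightarrow> ((j + i) mod p + (p - i)) mod p = j mod p"
  and shift_mod': "i < p \<Longrightarrow> ((j + (p - i)) mod p + i) mod p = j mod p"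
proof -
  assume i: "i < p"
  have "((j + i) mod p + (p - i)) mod p = (j + i + (p - i)) mod p"
    by (rule mod_add_left_eq)
  also have "j + i + (p - i) = j + p"
    using i by simp
  finally show "((j + i) mod p + (p - i)) mod p = j mod p"
    by simp
  have "((j + (p - i)) mod p + i) mod p = (j + (p - i) + i) mod p"
    by (rule mod_add_left_eq)
  also have "j + (p - i) + i = j + p"
    using i by simp
  finally show "((j + (p - i)) mod p + i) mod p = j mod p"
    by simp
qed

lemma bij_shift:
  assumes "i < p"
  shows "bij_betw (\<lambda>j. (j + i) mod p) {..<p} {..<p}"
  by (rule bij_betw_byWitness[of _ "\<lambda>j. (j + (p - i)) mod p"])
    (use assms p_pos in \<open>simp_all del: Nat.add_diff_assoc add: shift_mod shift_mod' image_subset_iff\<close>)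

lemma coprime_p: "\<not> p dvd n \<Longrightarrow> coprime n p"
  using prime_p prime_imp_coprime coprime_commute by blast

lemma w_mod: "w ^ (n mod p) = w ^ n"
proof -
  have "w ^ n = w ^ (p * (n div p) + n mod p)"
    by simp
  also have "\<dots> = w ^ (n mod p)"
    unfolding power_add power_mult w_pow_p by simp
  finally show ?thesis ..
qed

lemma w_cong: "[m = n] (mod p) \<Longrightarrow> w ^ m = w ^ n"
  by (metis cong_def w_mod)

lemma w_pow_eq_1_iff: "w ^ n = 1 \<longleftrightarrow> p dvd n"
proof
  assume n: "w ^ n = 1"
  show "p dvd n"
  proof (rule ccontr)
    assume "\<not> p dvd n"
    then obtain x where "[n * x = Suc 0] (mod p)"
      using coprime_p cong_solve_coprime_nat by blast
    then have "w ^ (n * x) = w"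
      using w_cong by fastforce
    then show False
      using n w_neq_1 by (simp add: power_mult)
  qed
qed (metis dvd_def power_mult power_one w_pow_p)

lemma sum_w_pow: "(\<Sum>i<p. w ^ (k * i)) = (if p dvd k then of_nat p else 0)"
proof (cases "p dvd k")
  case True
  then have "w ^ (k * i) = 1" for i
    by (simp add: w_pow_eq_1_iff)
  then show ?thesis
    using True by simp
next
  case False
  then have "w ^ k \<noteq> 1" by (simp add: w_pow_eq_1_iff)
  moreover have "(w ^ k) ^ p = 1"
    by (metis mult.commute power_mult power_one w_pow_p)
  ultimately have "(\<Sum>i<p. (w ^ k) ^ i) = 0"
    by (simp add: geometric_sum)
  then show ?thesis
    using False by (simp add: power_mult)
qed

section \<open>The ring Z[w]\<close>

definition R :: "complex set" where
  "R = {\<Sum>i<p. of_int (c i) * w ^ i | c :: nat \<Rightarrow> int. True}"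

lemma R_I: "(\<Sum>i<p. of_int (c i) * w ^ i) \<in> R"
  by (auto simp: R_def)

lemma R_add: assumes "x \<in> R" "y \<in> R" shows "x + y \<in> R"
proof -
  obtain c d :: "nat \<Rightarrow> int" where
    "x = (\<Sum>i<p. of_int (c i) * w ^ i)" "y = (\<Sum>i<p. of_int (d i) * w ^ i)"
    using assms by (auto simp: R_def)
  then have "x + y = (\<Sum>i<p. of_int (c i + d i) * w ^ i)"
    by (simp add: sum.distrib distrib_right)
  then show ?thesis
    using R_I by metis
qed

lemma R_scale: assumes "x \<in> R" shows "of_int a * x \<in> R"
proof -
  obtain c :: "nat \<Rightarrow> int" where "x = (\<Sum>i<p. of_int (c i) * w ^ i)"
    using assms by (auto simp: R_def)
  then have "of_int a * x = (\<Sum>i<p. of_int (a * c i) * w ^ i)"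
    by (simp add: sum_distrib_left mult.assoc)
  then show ?thesis
    using R_I by metis
qed

lemma R_0: "0 \<in> R"
  using R_I[of "\<lambda>_. 0"] by simp

lemma R_sum: "(\<And>i. i \<in> A \<Longrightarrow> f i \<in> R) \<Longrightarrow> sum f A \<in> R"
  by (induction A rule: infinite_finite_induct) (auto intro: R_0 R_add)

lemma R_w: "w ^ n \<in> R"
proof -
  have "(\<Sum>i<p. of_int (if i = n mod p then 1 else 0) * w ^ i) = w ^ n"
    using p_pos by (simp add: w_mod if_distrib[of of_int] if_distrib[of "\<lambda>x. x * _"] sum.delta cong: if_cong)
  then show ?thesis
    using R_I by metis
qed

lemma R_int: "of_int a \<in> R"
  using R_scale[OF R_w[of 0], of a] by simp

lemma R_mult: assumes "x \<in> R" "y \<in> R" shows "x * y \<in> R"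
proof -
  obtain c d :: "nat \<Rightarrow> int" where
    "x = (\<Sum>i<p. of_int (c i) * w ^ i)" "y = (\<Sum>i<p. of_int (d i) * w ^ i)"
    using assms by (auto simp: R_def)
  then have "x * y = (\<Sum>i<p. \<Sum>j<p. of_int (c i) * (of_int (d j) * w ^ (i + j)))"
    by (simp add: sum_product power_add mult_ac)
  also have "\<dots> \<in> R"
    by (intro R_sum R_scale R_w)
  finally show ?thesis .
qed

lemma R_1: "1 \<in> R" using R_int[of 1] by simp
lemma R_nat: "of_nat a \<in> R" using R_int[of "int a"] by simp
lemma R_uminus: "x \<in> R \<Longrightarrow> - x \<in> R" using R_scale[of x "-1"] by simp
lemma R_diff: "x \<in> R \<Longrightarrow> y \<in> R \<Longrightarrow> x - y \<in> R" using R_add[of x "-y"] R_uminus by simp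
lemma R_power: "x \<in> R \<Longrightarrow> x ^ n \<in> R" by (induction n) (auto intro: R_1 R_mult)
lemma R_prod: "(\<And>i. i \<in> A \<Longrightarrow> f i \<in> R) \<Longrightarrow> prod f A \<in> R"
  by (induction A rule: infinite_finite_induct) (auto intro: R_1 R_mult)
lemma R_w1: "w \<in> R" using R_w[of 1] by simp

lemmas R_intros = R_0 R_1 R_int R_nat R_w R_w1 R_add R_diff R_uminus R_mult R_power R_sum R_prod

text \<open>On the powers w^0, ..., w^(p-1), multiplication by \<open>x\<close> is given by an
  integer circulant matrix. The vector of powers is an eigenvector with eigenvalue \<open>x\<close>,
  so \<open>x\<close> is a root of a monic integer polynomial.\<close>

lemma R_algebraic_int:
  assumes "x \<in> R"
  shows "algebraic_int x"
proof -
  obtain c :: "nat \<Rightarrow> int" where x: "x = (\<Sum>i<p. of_int (c i) * w ^ i)"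
    using assms by (auto simp: R_def)
  \<comment> \<open>Entry (i, j) is the coefficient of w^j in x * w^i; its index is j - i modulo
    p.\<close>
  define A :: "int mat" where "A = mat p p (\<lambda>(i, j). c ((j + (p - i)) mod p))"
  define v where "v = vec p (\<lambda>i. w ^ i)"
  have A: "A \<in> carrier_mat p p"
    by (simp add: A_def)
  have row: "(\<Sum>j<p. of_int (c ((j + (p - i)) mod p)) * w ^ j) = x * w ^ i" if "i < p" for i
  proof -
    have "bij_betw (\<lambda>j. (j + i) mod p) {..<p} {..<p}"
      using that by (rule bij_shift)
    then have "(\<Sum>j<p. of_int (c ((j + (p - i)) mod p)) * w ^ j) =
        (\<Sum>j<p. of_int (c (((j + i) mod p + (p - i)) mod p)) * w ^ ((j + i) mod p))"
      by (rule sum.reindex_bij_betw[symmetric])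
    also have "\<dots> = (\<Sum>j<p. of_int (c j) * w ^ (j + i))"
      using that by (intro sum.cong) (simp_all del: Nat.add_diff_assoc add: w_mod shift_mod)
    finally show ?thesis
      by (simp add: x sum_distrib_left sum_distrib_right power_add mult_ac)
  qed
  have "map_mat of_int A *\<^sub>v v = x \<cdot>\<^sub>v v"
    by (rule eq_vecI) (auto simp: A_def v_def scalar_prod_def atLeast0LessThan row simp del: Nat.add_diff_assoc)
  moreover have "v \<noteq> 0\<^sub>v p"
  proof
    assume "v = 0\<^sub>v p"
    then have "v $ 0 = 0" using p_pos by simp
    then show False using p_pos by (simp add: v_def)
  qed
  ultimately have "eigenvalue (map_mat of_int A) x"
    unfolding eigenvalue_def eigenvector_def using A by (intro exI[of _ v]) (auto simp: v_def)
  then have "poly (char_poly (map_mat of_int A)) x = 0"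
    using A by (subst (asm) eigenvalue_root_char_poly[of _ p]) auto
  then have "poly (map_poly of_int (char_poly A)) x = 0"
    by (simp add: of_int_hom.char_poly_hom[OF A])
  moreover have "lead_coeff (char_poly A) = 1"
    using degree_monic_char_poly[OF A] by auto
  ultimately show ?thesis
    unfolding algebraic_int_altdef_ipoly by blast
qed

lemma R_rational:
  assumes "x \<in> R" "of_int b * x = of_int a" "b \<noteq> 0"
  shows "x \<in> \<int>"
proof -
  have "x = of_int a / of_int b"
    using assms by (simp add: field_simps)
  then have "x \<in> \<rat>"
    by simp
  then show ?thesis
    using rational_algebraic_int_is_int R_algebraic_int assms(1) by blast
qed

text \<open>A rational algebraic integer is an integer. This brings divisibilities proved in
  \<open>R\<close> back to the integers.\<close>

lemma R_dvd_int:
  assumes "of_int a = of_int b * x" "x \<in> R"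
  shows "b dvd a"
proof (cases "b = 0")
  case True
  then show ?thesis using assms by simp
next
  case False
  then obtain n where "x = of_int n"
    using R_rational[of x b a] assms by (auto elim: Ints_cases)
  then have "(of_int a :: complex) = of_int (b * n)"
    using assms by simp
  then show ?thesis
    unfolding of_int_eq_iff by simp
qed

section \<open>The element \<pi> and its relation to p\<close>

definition \<pi> :: complex where "\<pi> = w - 1"

lemma R_pi: "\<pi> \<in> R"
  by (simp add: \<pi>_def R_intros)

lemma pi_neq_0: "\<pi> \<noteq> 0"
  using w_neq_1 by (simp add: \<pi>_def)

text \<open>Expand 1 = (1 + \<pi>)^p, where p divides the inner binomial coefficients, and cancel
  one factor \<pi>.\<close>

lemma pi_power_eq: "\<exists>s\<in>R. \<pi> ^ (p - 1) = - of_nat p * (1 + \<pi> * s)"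
proof -
  define s where "s = (\<Sum>k\<in>{2..<p}. of_nat ((p choose k) div p) * \<pi> ^ (k - 2))"
  have s: "s \<in> R"
    unfolding s_def by (intro R_sum R_mult R_nat R_power R_pi)
  have term_eq: "of_nat (p choose k) * \<pi> ^ k = of_nat p * \<pi> * (\<pi> * (of_nat ((p choose k) div p) * \<pi> ^ (k - 2)))"
    if "k \<in> {2..<p}" for k
  proof -
    have "p dvd p choose k"
      by (rule dvd_choose_prime) (use that prime_p in auto)
    then have "p choose k = p * ((p choose k) div p)"
      by simp
    then have "(of_nat (p choose k) :: complex) = of_nat p * of_nat ((p choose k) div p)"
      by (metis of_nat_mult)
    moreover have "\<pi> ^ k = \<pi> * \<pi> * \<pi> ^ (k - 2)"
      using that by (metis atLeastLessThan_iff le_add_diff_inverse power2_eq_square power_add)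
    ultimately show ?thesis
      by simp
  qed
  have "1 = (\<pi> + 1) ^ p"
    by (simp add: \<pi>_def w_pow_p)
  also have "\<dots> = (\<Sum>k\<le>p. of_nat (p choose k) * \<pi> ^ k)"
    by (simp add: binomial_ring)
  also have "{..p} = insert 0 (insert 1 (insert p {2..<p}))"
    using p3 by auto
  also have "(\<Sum>k\<in>\<dots>. of_nat (p choose k) * \<pi> ^ k) =
      1 + (of_nat p * \<pi> + (\<pi> ^ p + (\<Sum>k\<in>{2..<p}. of_nat (p choose k) * \<pi> ^ k)))"
    using p3 by simp
  also have "(\<Sum>k\<in>{2..<p}. of_nat (p choose k) * \<pi> ^ k) = of_nat p * \<pi> * (\<pi> * s)"
    unfolding s_def sum_distrib_left by (rule sum.cong) (simp_all only: term_eq)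
  also have "\<pi> ^ p = \<pi> * \<pi> ^ (p - 1)"
    using p_pos by (metis power_eq_if neq0_conv)
  finally have "\<pi> * (of_nat p + \<pi> ^ (p - 1) + of_nat p * (\<pi> * s)) = 0"
    by (simp add: algebra_simps)
  then have "\<pi> ^ (p - 1) = - of_nat p * (1 + \<pi> * s)"
    using pi_neq_0 by (simp only: mult_eq_0_iff) (simp add: algebra_simps eq_neg_iff_add_eq_0)
  then show ?thesis
    using s by blast
qed

definition \<theta> :: complex where
  "\<theta> = (SOME s. s \<in> R \<and> \<pi> ^ (p - 1) = - of_nat p * (1 + \<pi> * s))"

lemma R_theta: "\<theta> \<in> R" and pi_power: "\<pi> ^ (p - 1) = - of_nat p * (1 + \<pi> * \<theta>)"
proof -
  have "\<theta> \<in> R \<and> \<pi> ^ (p - 1) = - of_nat p * (1 + \<pi> * \<theta>)"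
    unfolding \<theta>_def by (rule someI_ex) (use pi_power_eq in blast)
  then show "\<theta> \<in> R" "\<pi> ^ (p - 1) = - of_nat p * (1 + \<pi> * \<theta>)"
    by auto
qed

lemma p_eq_pi: "of_nat p = - (\<pi> ^ (p - 1)) - of_nat p * (\<pi> * \<theta>)"
  unfolding pi_power by (simp add: algebra_simps)

text \<open>The factor 1 + \<pi> * \<theta> is never inverted: \<open>p_eq_pi\<close> writes p as a
  sum of two terms that both show a factor \<pi>.\<close>

lemma p_pi: "\<exists>r\<in>R. of_nat p = \<pi> * r"
proof -
  have "\<pi> ^ (p - 1) = \<pi> * \<pi> ^ (p - 2)"
    using p3 power_Suc[of \<pi> "p - 2"] by (simp add: Suc_diff_Suc numeral_2_eq_2)
  then have "of_nat p = \<pi> * (- (\<pi> ^ (p - 2)) - of_nat p * \<theta>)"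
    using p_eq_pi by (simp add: right_diff_distrib mult.left_commute)
  then show ?thesis
    by (rule bexI) (intro R_intros R_pi R_theta)
qed

text \<open>Since p >= 3, \<pi>^(p-1) contains \<pi>^2; in the other term, p * \<pi> * \<theta>, the
  second \<pi> comes out of p by \<open>p_pi\<close>.\<close>

lemma p_pi2: "\<exists>r\<in>R. of_nat p = \<pi>\<^sup>2 * r"
proof -
  obtain q where q: "q \<in> R" "of_nat p = \<pi> * q"
    using p_pi by blast
  have "p - 1 = 2 + (p - 3)"
    using p3 by simp
  then have "\<pi> ^ (p - 1) = \<pi>\<^sup>2 * \<pi> ^ (p - 3)"
    by (metis power_add)
  moreover have "of_nat p * (\<pi> * \<theta>) = \<pi>\<^sup>2 * (q * \<theta>)"
    by (simp add: q(2) power2_eq_square)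
  ultimately have "of_nat p = \<pi>\<^sup>2 * (- (\<pi> ^ (p - 3)) - q * \<theta>)"
    using p_eq_pi by (simp only: right_diff_distrib mult_minus_right)
  then show ?thesis
    by (rule bexI) (intro R_intros R_pi R_theta q)
qed

text \<open>Raised to the power p - 1, the equation shows that p divides n^(p-1) in
  \<open>R\<close>, hence in the integers, and p is prime.\<close>

lemma pi_dvd_int:
  assumes "of_int n = \<pi> * r" "r \<in> R"
  shows "int p dvd n"
proof -
  have "of_int (n ^ (p - 1)) = \<pi> ^ (p - 1) * r ^ (p - 1)"
    by (simp add: assms(1) power_mult_distrib)
  also have "\<dots> = of_int (int p) * (- (1 + \<pi> * \<theta>) * r ^ (p - 1))"
    unfolding pi_power of_int_of_nat_eq by (simp only: minus_mult_minus mult_minus_left mult_minus_right mult.assoc)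
  finally have "int p dvd n ^ (p - 1)"
    by (rule R_dvd_int) (intro R_intros R_pi R_theta assms)
  then show ?thesis
    using prime_p prime_dvd_power by (metis prime_nat_int_transfer)
qed

lemma w_pow_pi: "\<exists>r\<in>R. w ^ n = 1 + of_nat n * \<pi> + \<pi>\<^sup>2 * r"
proof (induction n)
  case 0
  then show ?case by (intro bexI[of _ 0]) (auto intro: R_0)
next
  case (Suc n)
  then obtain r where r: "r \<in> R" "w ^ n = 1 + of_nat n * \<pi> + \<pi>\<^sup>2 * r"
    by blast
  have "w ^ Suc n = (1 + \<pi>) * w ^ n"
    by (simp add: \<pi>_def)
  also have "\<dots> = 1 + of_nat (Suc n) * \<pi> + \<pi>\<^sup>2 * (of_nat n + r + \<pi> * r)"
    unfolding r(2) by (simp add: algebra_simps power2_eq_square)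
  finally show ?case
    by (rule bexI) (intro R_intros R_pi r)
qed

section \<open>Sums over free orbits\<close>

text \<open>\<open>T\<close> generates a free action of the cyclic group of order p, and along an
  orbit \<open>W\<close> changes by powers of one root of unity w^m. An orbit therefore sums to p *
  W x or to 0, according to whether p divides m. The induction removes one orbit at a time.\<close>

lemma orbit_sum:
  assumes "finite X" "\<And>x. x \<in> X \<Longrightarrow> T x \<in> X" "\<And>x. x \<in> X \<Longrightarrow> (T ^^ p) x = x"
    "\<And>x. x \<in> X \<Longrightarrow> T x \<noteq> x" "\<And>x. x \<in> X \<Longrightarrow> W x \<in> R"
    "\<And>x. x \<in> X \<Longrightarrow> \<exists>m. \<forall>k. W ((T ^^ k) x) = w ^ (m * k) * W x"
  shows "\<exists>r\<in>R. (\<Sum>x\<in>X. W x) = of_nat p * r"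
  using assms
proof (induction "card X" arbitrary: X rule: less_induct)
  case less
  show ?case
  proof (cases "X = {}")
    case True
    then show ?thesis by (auto intro: bexI[of _ 0] R_0)
  next
    case False
    then obtain x where x: "x \<in> X" by blast
    define Q where "Q = (\<lambda>k. (T ^^ k) x) ` {..<p}"
    have in_X: "(T ^^ k) x \<in> X" for k
      by (induction k) (auto simp: x less.prems(2))
    have Q_all: "(T ^^ k) x \<in> Q" for k
    proof -
      have "(T ^^ (k mod p)) x = (T ^^ k) x"
        by (rule funpow_mod_eq) (rule less.prems(3)[OF x])
      moreover have "k mod p < p"
        using p_pos by simp
      ultimately show ?thesis
        unfolding Q_def by (metis imageI lessThan_iff)
    qed
    have QX: "Q \<subseteq> X" and xQ: "x \<in> Q"
      using in_X Q_all[of 0] by (auto simp: Q_def)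
    \<comment> \<open>If d were a period and d * n = 1 modulo p, then T^(d * n) would act on x both
      as T and as the identity.\<close>
    have no_fix: "(T ^^ d) x \<noteq> x" if d: "0 < d" "d < p" for d
    proof
      assume fix_d: "(T ^^ d) x = x"
      have "\<not> p dvd d"
        using d by (auto dest: dvd_imp_le)
      then obtain n where "[d * n = Suc 0] (mod p)"
        using coprime_p cong_solve_coprime_nat by blast
      then have n: "d * n mod p = 1"
        using p3 by (simp add: cong_def)
      have "(T ^^ (d * n mod p)) x = (T ^^ (d * n)) x"
        by (rule funpow_mod_eq) (rule less.prems(3)[OF x])
      also have "\<dots> = (T ^^ (d * n mod d)) x"
        by (rule funpow_mod_eq[symmetric]) (rule fix_d)
      finally show False
        using n less.prems(4)[OF x] by simp
    qed
    have inj: "inj_on (\<lambda>k. (T ^^ k) x) {..<p}"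
    proof (rule linorder_inj_onI)
      fix i j assume ij: "i < j" "i \<in> {..<p}" "j \<in> {..<p}"
      show "(T ^^ i) x \<noteq> (T ^^ j) x"
      proof
        assume "(T ^^ i) x = (T ^^ j) x"
        then have "(T ^^ (p - i)) ((T ^^ i) x) = (T ^^ (p - i)) ((T ^^ j) x)"
          by simp
        then have "(T ^^ (p - i + i)) x = (T ^^ (p - i + j)) x"
          by (simp only: funpow_add o_apply)
        moreover have "p - i + j = p + (j - i)" "p - i + i = p"
          using ij by auto
        moreover have "(T ^^ ((p + (j - i)) mod p)) x = (T ^^ (p + (j - i))) x"
          by (rule funpow_mod_eq) (rule less.prems(3)[OF x])
        ultimately show False
          using no_fix[of "j - i"] ij less.prems(3)[OF x] by (simp del: Nat.add_diff_assoc)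
      qed
    qed auto
    obtain m where m: "\<And>k. W ((T ^^ k) x) = w ^ (m * k) * W x"
      using less.prems(6)[OF x] by blast
    have "(\<Sum>y\<in>Q. W y) = (\<Sum>k<p. w ^ (m * k)) * W x"
      unfolding Q_def sum.reindex[OF inj] by (simp add: m sum_distrib_right)
    also have "\<dots> = of_nat p * (if p dvd m then W x else 0)"
      by (simp add: sum_w_pow)
    finally have sQ: "(\<Sum>y\<in>Q. W y) = of_nat p * (if p dvd m then W x else 0)" .
    have "\<exists>r\<in>R. (\<Sum>y\<in>X - Q. W y) = of_nat p * r"
    proof (rule less.hyps)
      show "card (X - Q) < card X"
        using x xQ less.prems(1) by (intro psubset_card_mono) auto
      fix y assume y: "y \<in> X - Q"
      show "T y \<in> X - Q"
      proof
        show "T y \<in> X" using y less.prems(2) by blast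
        \<comment> \<open>Otherwise p - 1 further applications of \<open>T\<close> would place y
          itself in the orbit.\<close>
        show "T y \<notin> Q"
        proof
          assume "T y \<in> Q"
          then obtain k where "T y = (T ^^ k) x"
            unfolding Q_def by blast
          then have "(T ^^ (p - 1)) (T y) = (T ^^ (p - 1 + k)) x"
            by (simp add: funpow_add)
          moreover have "(T ^^ (p - 1)) (T y) = (T ^^ p) y"
            using p_pos by (metis Suc_pred' funpow_Suc_right o_apply)
          ultimately show False
            using y less.prems(3)[of y] Q_all[of "p - 1 + k"] by auto
        qed
      qed
    qed (use less.prems in auto)
    then obtain r where r: "r \<in> R" "(\<Sum>y\<in>X - Q. W y) = of_nat p * r"
      by blast
    have "(\<Sum>y\<in>X. W y) = of_nat p * (r + (if p dvd m then W x else 0))"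
      using sum.subset_diff[OF QX less.prems(1), of W] sQ r by (simp add: distrib_left)
    then show ?thesis
      by (rule bexI) (use r less.prems(5)[OF x] in \<open>simp add: R_add R_0\<close>)
  qed
qed

subsection \<open>The block determinants modulo \<open>p\<close>\<close>

lemma ldet_shift_rows:
  fixes A :: "nat \<Rightarrow> nat \<Rightarrow> 'a :: comm_ring_1"
  assumes "k < p"
  shows "ldet [0..<p] (\<lambda>v v'. A ((v + k) mod p) ((v' + k) mod p)) = ldet [0..<p] A"
proof -
  have "ldet [0..<p] (\<lambda>v v'. A ((v + k) mod p) ((v' + k) mod p)) =
      ldet (map (\<lambda>v. (v + k) mod p) [0..<p]) A"
    by (simp add: ldet_map)
  also have "\<dots> = ldet [0..<p] A"
    using bij_shift[OF assms]
    by (intro ldet_perm) (simp_all add: distinct_map bij_betw_def atLeast0LessThan)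
  finally show ?thesis .
qed

text \<open>The sign of the rotation v -> v + j, kept as a determinant so that
  \<open>ldet_mult\<close> yields multiplicativity.\<close>

definition cshift :: "nat \<Rightarrow> int" where
  "cshift j = ldet [0..<p] (\<lambda>v v'. if (v + j) mod p = v' then 1 else 0)"

lemma cshift_add: "cshift (j + k) = cshift j * cshift k"
proof -
  have "(\<Sum>m\<in>set [0..<p]. (if (v + j) mod p = m then 1 else 0) * (if (m + k) mod p = v' then 1 else 0)) =
      (if (v + (j + k)) mod p = v' then 1 else 0 :: int)" for v v'
  proof -
    have "((v + j) mod p + k) mod p = (v + (j + k)) mod p"
      by (simp add: mod_add_left_eq add.assoc)
    then show ?thesis
      using p_pos by (simp add: if_distrib[of "\<lambda>x. x * _"] sum.delta' cong: if_cong)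
  qed
  then show ?thesis
    unfolding cshift_def ldet_mult[OF distinct_upt, symmetric] by simp
qed

lemma cshift_p: "p dvd j \<Longrightarrow> cshift j = 1"
proof -
  assume "p dvd j"
  then have "cshift j = ldet [0..<p] (\<lambda>v v'. if v = v' then 1 else 0)"
    unfolding cshift_def by (intro ldet_cong) (auto elim!: dvdE)
  also have "\<dots> = 1"
    by (subst ldet_diag) auto
  finally show ?thesis .
qed

text \<open>Its \<open>p\<close>-th power is the identity, and \<open>-1\<close> is excluded because \<open>p\<close> is odd.\<close>

lemma cshift_eq_1: "cshift j = 1"
proof -
  have "cshift (n * j) = cshift j ^ n" for n
    by (induction n) (simp_all add: cshift_p cshift_add)
  then have *: "cshift j ^ p = 1"
    by (metis cshift_p dvd_triv_left)
  then have "\<bar>cshift j\<bar> ^ p = 1 ^ p"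
    by (simp add: power_abs[symmetric])
  then have "\<bar>cshift j\<bar> = 1"
    using p_pos power_eq_iff_eq_base[of p "\<bar>cshift j\<bar>" 1] by linarith
  then consider "cshift j = 1" | "cshift j = - 1"
    by linarith
  then show ?thesis
  proof cases
    case 2
    then have "cshift j ^ p = - 1"
      using odd_p by simp
    then show ?thesis
      using * by simp
  qed
qed

definition triples :: "(nat \<times> nat \<times> nat) set" where
  "triples = {..<p} \<times> {..<p} \<times> {..<p}"

text \<open>The weight of x^i y^j z^l in row v. The part s * v * i of the exponent comes from y^v
  x^i = x^i y^v z^(v*i), with z acting as w^s.\<close>

definition coef :: "(nat \<Rightarrow> nat \<Rightarrow> nat \<Rightarrow> int) \<Rightarrow> nat \<Rightarrow> nat \<Rightarrow> nat \<Rightarrow> nat \<times> nat \<times> nat \<Rightarrow> complex" where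
  "coef a s u v = (\<lambda>(i, j, l). of_int (a i j l) * w ^ (s * l + (u + s * v) * i))"

text \<open>The determinant of F in the representation where z acts as w^s, x as the diagonal matrix
  of the w^(u + s*v), and y as the cyclic shift.\<close>

definition block :: "(nat \<Rightarrow> nat \<Rightarrow> nat \<Rightarrow> int) \<Rightarrow> nat \<Rightarrow> nat \<Rightarrow> complex" where
  "block a s u = ldet [0..<p] (\<lambda>v v'. \<Sum>k\<in>triples.
     coef a s u v k * (if (v + fst (snd k)) mod p = v' then 1 else 0))"

definition total :: "(nat \<Rightarrow> nat \<Rightarrow> nat \<Rightarrow> int) \<Rightarrow> int" where
  "total a = (\<Sum>(i, j, l)\<in>triples. a i j l)"

text \<open>The extra factor is independent of v, so rotating a choice of group elements over the
  rows multiplies its term by a root of unity, as \<open>orbit_sum\<close> requires.\<close>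

lemma coef_shift: "coef a s u ((v + k) mod p) g = w ^ (s * k * fst g) * coef a s u v g"
proof -
  obtain i j l where g: "g = (i, j, l)" by (cases g)
  have "[s * l + (u + s * ((v + k) mod p)) * i = s * l + (u + s * (v + k)) * i] (mod p)"
    by (intro cong_add cong_mult cong_refl) (simp add: cong_def)
  then have "w ^ (s * l + (u + s * ((v + k) mod p)) * i) = w ^ (s * l + (u + s * (v + k)) * i)"
    by (rule w_cong)
  also have "s * l + (u + s * (v + k)) * i = s * k * i + (s * l + (u + s * v) * i)"
    by (simp add: algebra_simps)
  finally show ?thesis
    by (simp add: g coef_def power_add mult_ac)
qed

lemma block_expand:
  "block a s u = (\<Sum>G\<in>{..<p} \<rightarrow>\<^sub>E triples. (\<Prod>v<p. coef a s u v (G v)) *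
     ldet [0..<p] (\<lambda>v v'. if (v + fst (snd (G v))) mod p = v' then 1 else 0))"
  unfolding block_def by (rule ldet_row_sums) (simp add: triples_def)

lemma sum_lessThan_dvd: "p dvd \<Sum>{..<p}"
proof -
  have "2 * \<Sum>{..<n} = n * (n - 1)" for n :: nat
    by (induction n) (auto simp: algebra_simps)
  then have "p dvd 2 * \<Sum>{..<p}"
    by simp
  moreover have "\<not> p dvd 2"
    using p3 by (auto dest: dvd_imp_le)
  ultimately show ?thesis
    using prime_p by (simp add: prime_dvd_mult_iff)
qed

text \<open>Over all rows the exponents add up to p(s l + u i) + s i p(p-1)/2, a multiple of p
  because p is odd.\<close>

lemma const_term:
  "(\<Prod>v<p. coef a s u v (i, j, l)) = of_int (a i j l) ^ p"
proof -
  have "(\<Sum>v<p. s * l + (u + s * v) * i) = p * (s * l + u * i) + s * i * \<Sum>{..<p}"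
    by (simp add: sum.distrib algebra_simps sum_distrib_left)
  then have "p dvd (\<Sum>v<p. s * l + (u + s * v) * i)"
    using sum_lessThan_dvd by simp
  then have "w ^ (\<Sum>v<p. s * l + (u + s * v) * i) = 1"
    by (simp add: w_pow_eq_1_iff)
  then show ?thesis
    by (simp add: coef_def prod.distrib power_sum)
qed

lemma R_coef: "coef a s u v g \<in> R"
  by (cases g) (simp add: coef_def R_intros)

text \<open>\<open>T\<close> rotates the choice functions of \<open>block_expand\<close>.
  \<open>orbit_sum\<close> handles those it moves; the constant ones are evaluated by
  \<open>const_term\<close> and \<open>cshift_eq_1\<close>.\<close>

lemma block_cong: "\<exists>r\<in>R. block a s u = of_int (total a) + of_nat p * r"
proof -
  define F where "F = {..<p} \<rightarrow>\<^sub>E triples"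
  define E where "E G = (of_int (ldet [0..<p] (\<lambda>v v'. if (v + fst (snd (G v))) mod p = v' then 1 else 0)) :: complex)"
    for G :: "nat \<Rightarrow> nat \<times> nat \<times> nat"
  define W where "W G = (\<Prod>v<p. coef a s u v (G v)) * E G" for G
  define T where "T G = restrict (\<lambda>v. G ((v + 1) mod p)) {..<p}" for G :: "nat \<Rightarrow> nat \<times> nat \<times> nat"
  have fin: "finite F"
    unfolding F_def triples_def by (intro finite_PiE) auto
  have TF: "T G \<in> F" if "G \<in> F" for G
    using that p_pos by (auto simp: F_def T_def PiE_iff)
  have Tk: "(T ^^ k) G = restrict (\<lambda>v. G ((v + k) mod p)) {..<p}" if "G \<in> F" for k G
  proof (induction k)
    case 0
    then show ?case
      using that by (auto simp: F_def fun_eq_iff PiE_iff extensional_def)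
  next
    case (Suc k)
    have "((v + 1) mod p + k) mod p = (v + Suc k) mod p" for v
      by (simp add: mod_add_left_eq)
    then have "T (restrict (\<lambda>v. G ((v + k) mod p)) {..<p}) = restrict (\<lambda>v. G ((v + Suc k) mod p)) {..<p}"
      using p_pos unfolding T_def by (intro restrict_ext) (simp only: restrict_apply lessThan_iff mod_less_divisor if_True)
    then show ?case
      by (simp only: funpow.simps o_apply Suc)
  qed
  have Tp: "(T ^^ p) G = G" if "G \<in> F" for G
    unfolding Tk[OF that] using that by (auto simp: F_def fun_eq_iff PiE_iff extensional_def)
  have block: "block a s u = (\<Sum>G\<in>F. W G)"
  proof -
    have "E G = ldet [0..<p] (\<lambda>v v'. if (v + fst (snd (G v))) mod p = v' then 1 else 0)" for G
      unfolding E_def ldet_of_int[symmetric] by (simp add: if_distrib cong: if_cong)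
    then show ?thesis
      unfolding block_expand W_def F_def by simp
  qed
  have WR: "W G \<in> R" for G
    unfolding W_def E_def by (intro R_intros R_coef)
  have WT: "\<exists>m. \<forall>k. W ((T ^^ k) G) = w ^ (m * k) * W G" if G: "G \<in> F" for G
  proof -
    define m where "m = s * (\<Sum>v<p. fst (G v))"
    have E_shift: "E ((T ^^ k) G) = E G" if k: "k < p" for k
    proof -
      have "ldet [0..<p] (\<lambda>v v'. if (v + fst (snd (G v))) mod p = v' then 1 else 0 :: int) =
          ldet [0..<p] (\<lambda>v v'. if ((v + k) mod p + fst (snd (G ((v + k) mod p)))) mod p = (v' + k) mod p
            then 1 else 0)"
        by (rule ldet_shift_rows[OF k, symmetric])
      also have "\<dots> = ldet [0..<p] (\<lambda>v v'. if (v + fst (snd ((T ^^ k) G v))) mod p = v' then 1 else 0)"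
      proof (rule ldet_cong, rule refl)
        fix v v' assume v: "v \<in> set [0..<p]" "v' \<in> set [0..<p]"
        define x where "x = fst (snd (G ((v + k) mod p)))"
        have "[v + k + x = v' + k] (mod p) \<longleftrightarrow> [v + x + k = v' + k] (mod p)"
          by (simp add: ac_simps)
        also have "\<dots> \<longleftrightarrow> [v + x = v'] (mod p)"
          by (rule cong_add_rcancel_nat)
        finally have "((v + k) mod p + x) mod p = (v' + k) mod p \<longleftrightarrow> (v + x) mod p = v'"
          using v by (simp add: cong_def mod_add_left_eq)
        then show "(if ((v + k) mod p + fst (snd (G ((v + k) mod p)))) mod p = (v' + k) mod p then 1 else 0) =
            (if (v + fst (snd ((T ^^ k) G v))) mod p = v' then 1 else (0::int))"
          using v by (simp add: Tk[OF G] x_def)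
      qed
      finally show ?thesis
        by (simp add: E_def)
    qed
    have W_shift: "W G = w ^ (m * k) * W ((T ^^ k) G)" if k: "k < p" for k
    proof -
      have "(\<Prod>v<p. coef a s u v (G v)) = (\<Prod>v<p. coef a s u ((v + k) mod p) (G ((v + k) mod p)))"
        by (rule prod.reindex_bij_betw[OF bij_shift[OF k], symmetric])
      also have "\<dots> = (\<Prod>v<p. w ^ (s * k * fst (G ((v + k) mod p)))) *
          (\<Prod>v<p. coef a s u v ((T ^^ k) G v))"
        unfolding coef_shift prod.distrib by (simp add: Tk[OF G])
      also have "(\<Prod>v<p. w ^ (s * k * fst (G ((v + k) mod p)))) = (\<Prod>v<p. w ^ (s * k * fst (G v)))"
        by (rule prod.reindex_bij_betw[OF bij_shift[OF k], of "\<lambda>v. w ^ (s * k * fst (G v))"])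
      also have "\<dots> = w ^ (m * k)"
        by (simp add: m_def power_sum[symmetric] sum_distrib_left mult_ac)
      finally show ?thesis
        unfolding W_def E_shift[OF k] by (simp add: mult.assoc)
    qed
    \<comment> \<open>\<open>W_shift\<close> has the root of unity on the other side; w^((p-1)*m*k)
      is the inverse of w^(m*k). Reducing k modulo p meets the bound in
      \<open>W_shift\<close>.\<close>
    have "W ((T ^^ k) G) = w ^ ((p - 1) * m * k) * W G" for k
    proof -
      have kp: "k mod p < p" using p_pos by simp
      have "[(p - 1) * m * k + m * (k mod p) = (p - 1) * m * k + m * k] (mod p)"
        by (intro cong_add cong_mult cong_refl) (simp add: cong_def)
      moreover have "(p - 1) * m * k + m * k = p * (m * k)"
        using p_pos by (cases p) (auto simp: algebra_simps)
      ultimately have "w ^ ((p - 1) * m * k + m * (k mod p)) = 1"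
        using w_cong w_pow_eq_1_iff by (metis dvd_triv_left)
      moreover have "(T ^^ (k mod p)) G = (T ^^ k) G"
        by (rule funpow_mod_eq) (rule Tp[OF G])
      ultimately show ?thesis
        using W_shift[OF kp] by (simp add: power_add)
    qed
    then show ?thesis
      by blast
  qed
  have "\<exists>r\<in>R. (\<Sum>G\<in>{G \<in> F. T G \<noteq> G}. W G) = of_nat p * r"
  proof (rule orbit_sum[of _ T])
    fix G assume G: "G \<in> {G \<in> F. T G \<noteq> G}"
    \<comment> \<open>Were T G fixed, G = T^(p-1) (T G) would equal T G.\<close>
    have "T (T G) \<noteq> T G"
    proof
      assume *: "T (T G) = T G"
      have "(T ^^ k) (T G) = T G" for k
        by (induction k) (simp_all add: *)
      then have "(T ^^ (p - 1)) (T G) = T G" .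
      moreover have "(T ^^ (p - 1)) (T G) = (T ^^ p) G"
        using p_pos by (metis Suc_pred' funpow_Suc_right o_apply)
      ultimately show False
        using G Tp by auto
    qed
    then show "T G \<in> {G \<in> F. T G \<noteq> G}"
      using G TF by auto
  qed (use fin Tp WR WT in auto)
  then obtain r where r: "r \<in> R" "(\<Sum>G\<in>{G \<in> F. T G \<noteq> G}. W G) = of_nat p * r"
    by blast
  define C where "C g = restrict (\<lambda>_. g) {..<p}" for g :: "nat \<times> nat \<times> nat"
  have fixed: "{G \<in> F. T G = G} = C ` triples"
  proof (intro equalityI subsetI)
    fix G assume "G \<in> {G \<in> F. T G = G}"
    then have G: "G \<in> F" and TG: "T G = G" by auto
    have "(T ^^ k) G = G" for k
      by (induction k) (simp_all add: TG)
    then have const: "G k = G 0" if "k < p" for k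
      using Tk[OF G, of k] that p_pos by (metis add_0 lessThan_iff mod_less restrict_apply')
    have "G = C (G 0)"
    proof
      show "G k = C (G 0) k" for k
        using G const[of k] by (cases "k < p") (simp_all add: C_def F_def PiE_iff extensional_def)
    qed
    moreover have "G 0 \<in> triples"
      using G p_pos by (auto simp: F_def)
    ultimately show "G \<in> C ` triples"
      by blast
  next
    fix G assume "G \<in> C ` triples"
    then obtain g where g: "g \<in> triples" "G = C g"
      by blast
    have "C g \<in> F"
      using g(1) by (auto simp: F_def C_def)
    moreover have "T (C g) = C g"
      using p_pos by (auto simp: T_def C_def fun_eq_iff)
    ultimately show "G \<in> {G \<in> F. T G = G}"
      using g(2) by simp
  qed
  have injC: "inj_on C triples"
    using p_pos by (auto simp: inj_on_def C_def fun_eq_iff)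
  have WC: "W (C (i, j, l)) = of_int (a i j l ^ p)" for i j l
  proof -
    have "E (C (i, j, l)) = of_int (cshift j)"
      unfolding E_def cshift_def by (intro arg_cong[where f = of_int] ldet_cong) (auto simp: C_def)
    then show ?thesis
      using const_term[of a s u i j l] by (simp add: W_def cshift_eq_1 C_def)
  qed
  have "int p dvd (\<Sum>(i, j, l)\<in>triples. a i j l ^ p - a i j l)"
    by (rule dvd_sum) (auto intro: fermat_int[OF prime_p])
  then obtain q where q: "(\<Sum>(i, j, l)\<in>triples. a i j l ^ p - a i j l) = int p * q"
    by (elim dvdE)
  have "(\<Sum>(i, j, l)\<in>triples. a i j l ^ p) = total a + int p * q"
    unfolding q[symmetric] total_def by (simp add: case_prod_unfold sum_subtractf)
  moreover have "(\<Sum>G\<in>{G \<in> F. T G = G}. W G) = of_int (\<Sum>(i, j, l)\<in>triples. a i j l ^ p)"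
    unfolding fixed sum.reindex[OF injC] of_int_sum by (intro sum.cong) (auto simp: WC)
  moreover have "(\<Sum>G\<in>F. W G) = (\<Sum>G\<in>{G \<in> F. T G = G}. W G) + (\<Sum>G\<in>{G \<in> F. T G \<noteq> G}. W G)"
    using fin by (subst sum.union_disjoint[symmetric]) (auto intro: sum.cong)
  ultimately have "block a s u = of_int (total a) + of_nat p * (of_int q + r)"
    by (simp add: block r algebra_simps)
  then show ?thesis
    by (rule bexI) (intro R_intros r)
qed

subsection \<open>Block decomposition of the group matrix\<close>

lemma carrier_heisenberg: "carrier (heisenberg p) = triples"
  by (simp add: heisenberg_def triples_def atLeast0LessThan)

lemma finite_triples: "finite triples"
  by (simp add: triples_def)

text \<open>
  The span of the functions \<open>(a, b, c) \<mapsto> \<omega>\<^bsup>s c + u a\<^esup> [b = v]\<close> with fixed \<open>s, u\<close> is invariant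
  under right translation, so the partial Fourier transform in \<open>a\<close> and \<open>c\<close>
  makes the group matrix block diagonal.
\<close>

lemma heis_det_blocks: "of_int (heis_det p a) = (\<Prod>s<p. \<Prod>u<p. block a s u)"
proof -
  interpret group "heisenberg p"
    by (rule group_heisenberg) (rule p_pos)
  define f :: "nat \<times> nat \<Rightarrow> (nat \<times> nat \<times> nat) list" where "f = (\<lambda>(s, u). map (\<lambda>v. (s, u, v)) [0..<p])"
  define zs where "zs = List.product [0..<p] [0..<p]"
  define xs where "xs = concat (map f zs)"
  have dzs: "distinct zs"
    unfolding zs_def by (intro distinct_product) auto
  have set_zs: "set zs = {..<p} \<times> {..<p}"
    by (auto simp: zs_def)
  have set_xs: "set xs = triples"
    by (auto simp: xs_def f_def set_zs triples_def)
  have "length xs = p * p * p"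
  proof -
    have "map (length \<circ> f) zs = map (\<lambda>_. p) zs"
      by (rule map_cong) (auto simp: f_def)
    then have "length xs = sum_list (map (\<lambda>_. p) zs)"
      unfolding xs_def length_concat map_map by (rule arg_cong)
    then show ?thesis
      by (simp add: sum_list_triv zs_def)
  qed
  \<comment> \<open>A list of p^3 entries that covers p^3 elements has no repetitions.\<close>
  then have dxs: "distinct xs"
    by (intro card_distinct) (simp add: set_xs triples_def)
  define a3 where "a3 = (\<lambda>(i, j, l). a i j l)"
  define A :: "nat \<times> nat \<times> nat \<Rightarrow> nat \<times> nat \<times> nat \<Rightarrow> complex" where
    "A g h = of_int (a3 (inv\<^bsub>heisenberg p\<^esub> g \<otimes>\<^bsub>heisenberg p\<^esub> h))" for g h
  define B :: "nat \<times> nat \<times> nat \<Rightarrow> nat \<times> nat \<times> nat \<Rightarrow> complex" where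
    "B = (\<lambda>(s, u, v) (s', u', v'). if s = s' \<and> u = u' then
      (\<Sum>k\<in>triples. coef a s u v k * (if (v + fst (snd k)) mod p = v' then 1 else 0)) else 0)"
  define P :: "nat \<times> nat \<times> nat \<Rightarrow> nat \<times> nat \<times> nat \<Rightarrow> complex" where
    "P = (\<lambda>(x, y, z) (s, u, v). w ^ (s * z + u * x) * (if y = v then 1 else 0))"
  \<comment> \<open>\<open>Q\<close> conjugates the characters in \<open>P\<close>, with p - z and p
    - x in place of -z and -x.\<close>
  define Q :: "nat \<times> nat \<times> nat \<Rightarrow> nat \<times> nat \<times> nat \<Rightarrow> complex" where
    "Q = (\<lambda>(s, u, v) (x, y, z). w ^ (s * (p - z) + u * (p - x)) * (if y = v then 1 else 0))"
  have "of_int (heis_det p a) = ldet xs A"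
  proof -
    \<comment> \<open>Listing the inverses turns the entries a(g h^-1) into a(g^-1 h), so that the
      matrix acts on functions by right translations.\<close>
    have "group_det (heisenberg p) a3 =
        det (group_matrix (heisenberg p) (map (m_inv (heisenberg p)) xs) a3)"
    proof (rule group_det_eq)
      show "distinct (map (m_inv (heisenberg p)) xs)"
        using dxs inv_inj by (simp add: distinct_map set_xs carrier_heisenberg)
      show "set (map (m_inv (heisenberg p)) xs) = carrier (heisenberg p)"
        using inv_inj by (auto simp: set_xs carrier_heisenberg[symmetric] image_iff) (metis inv_closed inv_inv)
    qed
    also have "\<dots> = ldet (map (m_inv (heisenberg p)) xs)
        (\<lambda>g h. a3 (g \<otimes>\<^bsub>heisenberg p\<^esub> inv\<^bsub>heisenberg p\<^esub> h))"
      by (simp add: group_matrix_def ldet_def)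
    also have "\<dots> = ldet xs (\<lambda>g h. a3 (inv\<^bsub>heisenberg p\<^esub> g \<otimes>\<^bsub>heisenberg p\<^esub> h))"
      unfolding ldet_map by (rule ldet_cong) (simp_all add: set_xs carrier_heisenberg[symmetric])
    finally show ?thesis
      unfolding A_def ldet_of_int by (simp add: heis_det_def a3_def)
  qed
  also have "\<dots> = ldet xs B"
  proof (rule ldet_similar[OF dxs, where P = P and Q = Q and c = "of_nat (p * p)"])
    fix g \<kappa>
    assume "g \<in> set xs" "\<kappa> \<in> set xs"
    then have g: "g \<in> triples" and \<kappa>: "\<kappa> \<in> triples"
      by (simp_all add: set_xs)
    obtain x y z where gx: "g = (x, y, z)" by (cases g)
    obtain s u v where \<kappa>s: "\<kappa> = (s, u, v)" by (cases \<kappa>)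
    \<comment> \<open>After the substitution h = g k the coefficient of F no longer depends on
      g.\<close>
    have bij: "bij_betw (\<lambda>k. g \<otimes>\<^bsub>heisenberg p\<^esub> k) triples triples"
      by (rule bij_betw_byWitness[of _ "\<lambda>k. inv\<^bsub>heisenberg p\<^esub> g \<otimes>\<^bsub>heisenberg p\<^esub> k"])
        (use g in \<open>auto simp: carrier_heisenberg[symmetric] m_assoc[symmetric]\<close>)
    have "(\<Sum>h\<in>triples. A g h * P h \<kappa>) =
        (\<Sum>k\<in>triples. A g (g \<otimes>\<^bsub>heisenberg p\<^esub> k) * P (g \<otimes>\<^bsub>heisenberg p\<^esub> k) \<kappa>)"
      by (rule sum.reindex_bij_betw[OF bij, symmetric])
    also have "\<dots> = (\<Sum>k\<in>triples. w ^ (s * z + u * x) *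
        (coef a s u y k * (if (y + fst (snd k)) mod p = v then 1 else 0)))"
    proof (rule sum.cong, rule refl)
      fix k assume k: "k \<in> triples"
      obtain i j l where kl: "k = (i, j, l)" by (cases k)
      have "A g (g \<otimes>\<^bsub>heisenberg p\<^esub> k) = of_int (a i j l)"
        using g k by (simp add: A_def carrier_heisenberg[symmetric] m_assoc[symmetric]) (simp add: a3_def kl)
      moreover have "P (g \<otimes>\<^bsub>heisenberg p\<^esub> k) \<kappa> =
          w ^ (s * ((z + l + y * i) mod p) + u * ((x + i) mod p)) * (if (y + j) mod p = v then 1 else 0)"
        by (simp add: P_def gx kl \<kappa>s heisenberg_def)
      moreover have "w ^ (s * ((z + l + y * i) mod p) + u * ((x + i) mod p)) =
          w ^ (s * (z + l + y * i) + u * (x + i))"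
        by (intro w_cong cong_add cong_mult cong_refl) (simp_all add: cong_def)
      moreover have "s * (z + l + y * i) + u * (x + i) = (s * z + u * x) + (s * l + (u + s * y) * i)"
        by (simp add: algebra_simps)
      ultimately show "A g (g \<otimes>\<^bsub>heisenberg p\<^esub> k) * P (g \<otimes>\<^bsub>heisenberg p\<^esub> k) \<kappa> =
          w ^ (s * z + u * x) * (coef a s u y k * (if (y + fst (snd k)) mod p = v then 1 else 0))"
        by (simp only: power_add) (simp add: kl coef_def power_add)
    qed
    also have "\<dots> = (\<Sum>\<kappa>'\<in>triples. if \<kappa>' = (s, u, y) then w ^ (s * z + u * x) * B (s, u, y) \<kappa> else 0)"
      using g \<kappa> finite_triples
      by (simp add: gx \<kappa>s B_def sum_distrib_left[symmetric] sum.delta) (simp add: triples_def)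
    also have "\<dots> = (\<Sum>\<kappa>'\<in>triples. P g \<kappa>' * B \<kappa>' \<kappa>)"
    proof (rule sum.cong, rule refl)
      fix \<kappa>' assume "\<kappa>' \<in> triples"
      obtain s' u' v' where "\<kappa>' = (s', u', v')" by (cases \<kappa>')
      then show "(if \<kappa>' = (s, u, y) then w ^ (s * z + u * x) * B (s, u, y) \<kappa> else 0) = P g \<kappa>' * B \<kappa>' \<kappa>"
        by (cases "s' = s \<and> u' = u"; cases "v' = y") (auto simp: P_def B_def gx \<kappa>s)
    qed
    finally show "(\<Sum>k\<in>set xs. A g k * P k \<kappa>) = (\<Sum>k\<in>set xs. P g k * B k \<kappa>)"
      by (simp add: set_xs)
  next
    fix g h
    assume gh: "g \<in> set xs" "h \<in> set xs"
    obtain x y z where gx: "g = (x, y, z)" by (cases g)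
    obtain x' y' z' where hx: "h = (x', y', z')" by (cases h)
    have lt: "x < p" "y < p" "z < p" "x' < p" "y' < p" "z' < p"
      using gh by (auto simp: gx hx set_xs triples_def)
    have dvd: "p dvd m + (p - m') \<longleftrightarrow> m = m'" if m: "m < p" "m' < p" for m m'
    proof
      assume "p dvd m + (p - m')"
      then have "((m + (p - m')) mod p + m') mod p = m'"
        using m by (simp add: dvd_eq_mod_eq_0 del: Nat.add_diff_assoc)
      then show "m = m'"
        using shift_mod'[OF m(2), of m] m by simp
    qed (use m in auto)
    have "(\<Sum>k\<in>triples. P g k * Q k h) =
        (\<Sum>s<p. \<Sum>u<p. \<Sum>v<p. w ^ ((z + (p - z')) * s) * w ^ ((x + (p - x')) * u) *
          (if y = v then if y' = v then 1 else 0 else 0))"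
    proof -
      have "P g (s, u, v) * Q (s, u, v) h = w ^ ((z + (p - z')) * s) * w ^ ((x + (p - x')) * u) *
          (if y = v then if y' = v then 1 else 0 else 0)" for s u v
      proof -
        have "w ^ (s * z + u * x) * w ^ (s * (p - z') + u * (p - x')) =
            w ^ ((z + (p - z')) * s) * w ^ ((x + (p - x')) * u)"
          unfolding power_add[symmetric] by (intro arg_cong[where f = "(^) w"])
            (simp only: distrib_left distrib_right mult_ac add_ac)
        then show ?thesis
          by (auto simp: P_def Q_def gx hx)
      qed
      then show ?thesis
        by (simp only: triples_def sum.cartesian_product')
    qed
    also have "\<dots> = (\<Sum>s<p. \<Sum>u<p. w ^ ((z + (p - z')) * s) * w ^ ((x + (p - x')) * u)) *
        (if y = y' then 1 else 0)"
      unfolding sum_distrib_left[symmetric] sum_distrib_right[symmetric]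
      using lt by (simp add: sum.delta' cong: if_cong)
    \<comment> \<open>Only two of the three coordinates are Fourier transformed, hence p^2 and not
      p^3.\<close>
    also have "\<dots> = (if g = h then of_nat (p * p) else 0)"
      unfolding sum_product[symmetric] sum_w_pow using lt by (simp add: dvd gx hx del: Nat.add_diff_assoc)
    finally show "(\<Sum>k\<in>set xs. P g k * Q k h) = (if g = h then of_nat (p * p) else 0)"
      by (simp add: set_xs)
  qed (use p_pos in simp)
  also have "\<dots> = (\<Prod>z\<in>set zs. ldet (f z) B)"
    unfolding xs_def by (rule ldet_concat[OF dzs]) (auto simp: f_def B_def split: if_splits)
  also have "\<dots> = (\<Prod>(s, u)\<in>{..<p} \<times> {..<p}. block a s u)"
    unfolding set_zs by (intro prod.cong) (auto simp: f_def ldet_map B_def block_def)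
  finally show ?thesis
    by (simp add: prod.cartesian_product)
qed

section \<open>The blocks with s = 0\<close>

text \<open>F(w^u, w^v, 1), the value of F at a one-dimensional character of the group.\<close>

definition fval :: "(nat \<Rightarrow> nat \<Rightarrow> nat \<Rightarrow> int) \<Rightarrow> nat \<Rightarrow> nat \<Rightarrow> complex" where
  "fval a u v = (\<Sum>(i, j, l)\<in>triples. of_int (a i j l) * w ^ (u * i + v * j))"

text \<open>For s = 0 the weights do not depend on the row, so the matrix is circulant and the
  Fourier matrix diagonalises it.\<close>

lemma block_0: "block a 0 u = (\<Prod>v<p. fval a u v)"
proof -
  let ?P = "\<lambda>x v. w ^ (x * v)" and ?Q = "\<lambda>v x. w ^ (v * (p - x))"
  have "block a 0 u = ldet [0..<p] (\<lambda>v v'. if v = v' then fval a u v else 0)"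
    unfolding block_def
  proof (rule ldet_similar[where P = ?P and Q = ?Q and c = "of_nat p"])
    fix x v assume xv: "x \<in> set [0..<p]" "v \<in> set [0..<p]"
    have "(\<Sum>y\<in>set [0..<p]. (\<Sum>k\<in>triples. coef a 0 u x k * (if (x + fst (snd k)) mod p = y then 1 else 0)) * w ^ (y * v)) =
        (\<Sum>k\<in>triples. \<Sum>y<p. if (x + fst (snd k)) mod p = y then coef a 0 u x k * w ^ (y * v) else 0)"
      by (subst sum.swap) (auto simp: sum_distrib_right atLeast0LessThan intro!: sum.cong)
    also have "\<dots> = (\<Sum>k\<in>triples. coef a 0 u x k * w ^ ((x + fst (snd k)) mod p * v))"
      using p_pos by (simp add: sum.delta' cong: if_cong)
    also have "\<dots> = (\<Sum>k\<in>triples. w ^ (x * v) * (case k of (i, j, l) \<Rightarrow> of_int (a i j l) * w ^ (u * i + v * j)))"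
    proof (rule sum.cong, rule refl)
      fix k assume "k \<in> triples"
      obtain i j l where k: "k = (i, j, l)" by (cases k)
      have "w ^ ((x + j) mod p * v) = w ^ ((x + j) * v)"
        by (intro w_cong cong_mult cong_refl) (simp add: cong_def)
      then show "coef a 0 u x k * w ^ ((x + fst (snd k)) mod p * v) =
          w ^ (x * v) * (case k of (i, j, l) \<Rightarrow> of_int (a i j l) * w ^ (u * i + v * j))"
        by (simp add: k coef_def power_add[symmetric] algebra_simps)
    qed
    also have "\<dots> = (\<Sum>y\<in>set [0..<p]. w ^ (x * y) * (if y = v then fval a u y else 0))"
      using xv by (simp add: fval_def sum_distrib_left[symmetric] if_distrib[of "\<lambda>x. _ * x"] sum.delta cong: if_cong)
    finally show "(\<Sum>y\<in>set [0..<p]. (\<Sum>k\<in>triples. coef a 0 u x k * (if (x + fst (snd k)) mod p = y then 1 else 0)) * w ^ (y * v)) =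
        (\<Sum>y\<in>set [0..<p]. w ^ (x * y) * (if y = v then fval a u y else 0))" .
  next
    fix x y assume xy: "x \<in> set [0..<p]" "y \<in> set [0..<p]"
    have "(\<Sum>v\<in>set [0..<p]. w ^ (x * v) * w ^ (v * (p - y))) = (\<Sum>v<p. w ^ ((x + (p - y)) * v))"
      by (intro sum.cong) (auto simp: power_add[symmetric] algebra_simps simp del: Nat.add_diff_assoc diff_mult_distrib2)
    also have "\<dots> = (if x = y then of_nat p else 0)"
    proof -
      have "p dvd x + (p - y) \<longleftrightarrow> x = y"
      proof
        assume "p dvd x + (p - y)"
        then have "((x + (p - y)) mod p + y) mod p = y"
          using xy by (simp add: dvd_eq_mod_eq_0 del: Nat.add_diff_assoc)
        then show "x = y"
          using shift_mod'[of y x] xy by simp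
      qed (use xy in auto)
      then show ?thesis
        unfolding sum_w_pow by simp
    qed
    finally show "(\<Sum>v\<in>set [0..<p]. w ^ (x * v) * w ^ (v * (p - y))) = (if x = y then of_nat p else 0)" .
  qed (use p_pos in simp_all)
  then show ?thesis
    by (simp add: ldet_diag atLeast0LessThan)
qed

subsection \<open>Divisibility\<close>

lemma prod_cong_mod:
  assumes "finite A" "d \<in> R" "\<And>x. x \<in> A \<Longrightarrow> \<exists>r\<in>R. f x = of_int (g x) + d * r"
  shows "\<exists>r\<in>R. prod f A = of_int (prod g A) + d * r"
  using assms
proof (induction A rule: finite_induct)
  case empty
  then show ?case by (auto intro: bexI[of _ 0] R_0)
next
  case (insert x A)
  then obtain r where r: "r \<in> R" "prod f A = of_int (prod g A) + d * r"
    by auto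
  obtain q where q: "q \<in> R" "f x = of_int (g x) + d * q"
    using insert.prems by auto
  have "prod f (insert x A) = of_int (prod g (insert x A)) + d * (of_int (g x) * r + q * of_int (prod g A) + d * (q * r))"
    using insert.hyps by (simp add: r(2) q(2)) (simp add: algebra_simps)
  then show ?case
    by (rule bexI) (intro R_intros r q \<open>d \<in> R\<close>)
qed

lemma prod_divisible:
  assumes "finite A" "\<And>x. x \<in> A \<Longrightarrow> \<exists>r\<in>R. f x = d * r"
  shows "\<exists>r\<in>R. prod f A = d ^ card A * r"
proof -
  obtain r where r: "\<And>x. x \<in> A \<Longrightarrow> r x \<in> R \<and> f x = d * r x"
    using assms(2) by metis
  have "prod f A = d ^ card A * prod r A"
    using r by (simp add: prod.distrib[symmetric] prod_constant[symmetric] del: prod_constant)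
  then show ?thesis
    by (rule bexI) (use r in \<open>auto intro: R_prod\<close>)
qed

text \<open>\<open>w_pow_pi\<close> gives a first-order Taylor expansion; the two integer sums are
  the partial derivatives of F in x and y at (1,1,1).\<close>

lemma fval_expand:
  "\<exists>r\<in>R. fval a u v = of_int (total a) + of_int (int u * (\<Sum>(i, j, l)\<in>triples. a i j l * int i) +
     int v * (\<Sum>(i, j, l)\<in>triples. a i j l * int j)) * \<pi> + \<pi>\<^sup>2 * r"
proof -
  obtain r where r: "\<And>n. r n \<in> R \<and> w ^ n = 1 + of_nat n * \<pi> + \<pi>\<^sup>2 * r n"
    using w_pow_pi by metis
  have "fval a u v = (\<Sum>(i, j, l)\<in>triples. of_int (a i j l) + of_int (int u * (a i j l * int i) + int v * (a i j l * int j)) * \<pi>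
      + \<pi>\<^sup>2 * (of_int (a i j l) * r (u * i + v * j)))"
    unfolding fval_def
  proof (intro sum.cong refl, clarify)
    fix i j l
    have "w ^ (u * i + v * j) = 1 + of_nat (u * i + v * j) * \<pi> + \<pi>\<^sup>2 * r (u * i + v * j)"
      using r by blast
    then show "of_int (a i j l) * w ^ (u * i + v * j) = of_int (a i j l) + of_int (int u * (a i j l * int i) + int v * (a i j l * int j)) * \<pi>
      + \<pi>\<^sup>2 * (of_int (a i j l) * r (u * i + v * j))"
      by (simp only:) (simp add: algebra_simps)
  qed
  also have "\<dots> = of_int (total a) + of_int (int u * (\<Sum>(i, j, l)\<in>triples. a i j l * int i) +
     int v * (\<Sum>(i, j, l)\<in>triples. a i j l * int j)) * \<pi> + \<pi>\<^sup>2 * (\<Sum>(i, j, l)\<in>triples. of_int (a i j l) * r (u * i + v * j))"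
    by (simp add: total_def case_prod_unfold sum.distrib sum_distrib_left sum_distrib_right distrib_right)
  finally show ?thesis
    by (rule bexI) (auto intro!: R_sum R_mult R_int simp: r case_prod_unfold)
qed

text \<open>Modulo p all p^2 blocks equal \<open>total a\<close>, so p divides a power of
  \<open>total a\<close>.\<close>

lemma p_dvd_total:
  assumes "int p dvd heis_det p a"
  shows "int p dvd total a"
proof -
  have "\<exists>r\<in>R. (\<Prod>(s, u)\<in>{..<p} \<times> {..<p}. block a s u) = of_int (\<Prod>(s, u)\<in>{..<p} \<times> {..<p}. total a) + of_nat p * r"
    by (rule prod_cong_mod) (use block_cong in \<open>auto intro: R_nat\<close>)
  then obtain r where r: "r \<in> R" "of_int (heis_det p a) = of_int (total a ^ (p * p)) + of_nat p * r"
    unfolding heis_det_blocks prod.cartesian_product by (auto simp: case_prod_unfold)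
  obtain q where "heis_det p a = int p * q"
    using assms by (elim dvdE)
  then have "of_int (total a ^ (p * p)) = of_int (int p) * (of_int q - r)"
    using r(2) by (simp add: algebra_simps)
  then have "int p dvd total a ^ (p * p)"
    by (rule R_dvd_int) (intro R_intros r)
  then show ?thesis
    using prime_p prime_dvd_power by (metis prime_nat_int_transfer)
qed

text \<open>
  The integer vector \<open>(\<beta>, -\<alpha>)\<close>, or any vector if it vanishes mod \<open>p\<close>, spans a line of solutions.
\<close>

lemma card_linear_solutions:
  fixes \<alpha> \<beta> :: int
  shows "p - 1 \<le> card {(u, v). u < p \<and> v < p \<and> (u, v) \<noteq> (0, 0) \<and> int p dvd int u * \<alpha> + int v * \<beta>}"
proof -
  obtain c d :: int where cd: "int p dvd c * \<alpha> + d * \<beta>" "\<not> (int p dvd c \<and> int p dvd d)"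
  proof (cases "int p dvd \<alpha> \<and> int p dvd \<beta>")
    case True
    have "int p dvd 1 * \<alpha> + 0 * \<beta>"
      using True by simp
    moreover have "\<not> int p dvd 1"
      using p3 by simp
    ultimately show ?thesis
      using that by blast
  next
    case False
    have "int p dvd \<beta> * \<alpha> + (- \<alpha>) * \<beta>"
      by simp
    then show ?thesis
      using that[of \<beta> "- \<alpha>"] False by auto
  qed
  define f where "f t = (nat (int t * c mod int p), nat (int t * d mod int p))" for t
  let ?Z = "{(u, v). u < p \<and> v < p \<and> (u, v) \<noteq> (0, 0) \<and> int p dvd int u * \<alpha> + int v * \<beta>}"
  have pp: "prime (int p)"
    using prime_p by simp
  have p0: "int p > 0"
    using p_pos by simp
  have unique: "t = t'" if t: "t < p" "t' < p" and eq: "f t = f t'" for t t'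
  proof -
    have "int p dvd (int t - int t') * c" "int p dvd (int t - int t') * d"
      using eq p0 by (simp_all add: f_def eq_nat_nat_iff mod_eq_dvd_iff left_diff_distrib)
    then have "int p dvd int t - int t'"
      using cd(2) by (auto simp: prime_dvd_mult_iff[OF pp])
    then have "int t mod int p = int t' mod int p"
      by (simp add: mod_eq_dvd_iff)
    then show ?thesis
      using t by simp
  qed
  have "f ` {1..<p} \<subseteq> ?Z"
  proof
    fix z assume "z \<in> f ` {1..<p}"
    then obtain t where t: "1 \<le> t" "t < p" "z = f t"
      by auto
    \<comment> \<open>Injectivity on 0, ..., p - 1 keeps f t away from the origin.\<close>
    have "f t \<noteq> f 0"
      using unique[of t 0] t p_pos by auto
    moreover have "f 0 = (0, 0)"
      by (simp add: f_def)
    moreover have "int p dvd (int t * c mod int p) * \<alpha> + (int t * d mod int p) * \<beta>"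
    proof -
      have "[(int t * c mod int p) * \<alpha> + (int t * d mod int p) * \<beta> = int t * c * \<alpha> + int t * d * \<beta>] (mod int p)"
        by (intro cong_add cong_mult cong_refl) (simp_all add: cong_def)
      moreover have "int t * c * \<alpha> + int t * d * \<beta> = int t * (c * \<alpha> + d * \<beta>)"
        by (simp add: algebra_simps)
      ultimately show ?thesis
        using cd(1) by (metis cong_dvd_iff dvd_mult)
    qed
    ultimately show "z \<in> ?Z"
      using p0 by (auto simp: t(3) f_def nat_less_iff)
  qed
  moreover have "finite ?Z"
    by (rule finite_subset[of _ "{..<p} \<times> {..<p}"]) auto
  ultimately have "card (f ` {1..<p}) \<le> card ?Z"
    by (intro card_mono)
  moreover have "inj_on f {1..<p}"
    using unique by (intro inj_onI) auto
  ultimately show ?thesis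
    by (simp add: card_image)
qed

lemma prod_split_0: "(\<Prod>s<p. g s) = g 0 * (\<Prod>s\<in>{1..<p}. g s)" for g :: "nat \<Rightarrow> complex"
proof -
  have "{..<p} = insert 0 {1..<p}"
    using p_pos by auto
  then show ?thesis
    by simp
qed

text \<open>The trivial character is split off because its value \<open>total a\<close> is an
  integer and gains a full factor p.\<close>

lemma heis_det_factors:
  "of_int (heis_det p a) = of_int (total a) *
    (\<Prod>(u, v)\<in>{..<p} \<times> {..<p} - {(0, 0)}. fval a u v) * (\<Prod>(s, u)\<in>{1..<p} \<times> {..<p}. block a s u)"
proof -
  have "fval a 0 0 = of_int (total a)"
    by (simp add: fval_def total_def case_prod_unfold)
  then have "(\<Prod>(u, v)\<in>{..<p} \<times> {..<p}. fval a u v) =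
      of_int (total a) * (\<Prod>(u, v)\<in>{..<p} \<times> {..<p} - {(0, 0)}. fval a u v)"
    using p_pos by (subst prod.remove[of _ "(0, 0)"]) auto
  then show ?thesis
    unfolding heis_det_blocks prod_split_0[of "\<lambda>s. \<Prod>u<p. block a s u"] block_0
    by (simp add: prod.cartesian_product)
qed

text \<open>Bookkeeping of exponents: p^2 - 1 factors \<pi> and p - 1 extra ones make (p-1)(p+2).
  The second equation adds the powers of p from the trivial character, from these factors, and from
  the blocks with s > 0.\<close>

lemma p_sq: "(p - 1) * (p + 2) + 2 = p\<^sup>2 + p" "p\<^sup>2 + 3 = 1 + (p + 2) + (p - 1) * p"
proof -
  obtain m where "p = Suc m"
    using p_pos by (cases p) auto
  then show "(p - 1) * (p + 2) + 2 = p\<^sup>2 + p" "p\<^sup>2 + 3 = 1 + (p + 2) + (p - 1) * p"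
    by (simp_all add: power2_eq_square algebra_simps)
qed

lemma pi_power_mult: "\<exists>r\<in>R. \<pi> ^ ((p - 1) * m) = of_nat p ^ m * r"
proof -
  have "\<pi> ^ ((p - 1) * m) = of_nat p ^ m * (- (1 + \<pi> * \<theta>)) ^ m"
    unfolding power_mult pi_power power_mult_distrib[symmetric] by (simp only: mult_minus_left mult_minus_right)
  then show ?thesis
    by (rule bexI) (intro R_intros R_pi R_theta)
qed

lemma heis_det_divisible:
  assumes "int p dvd heis_det p a"
  shows "int p ^ (p\<^sup>2 + 3) dvd heis_det p a"
proof -
  obtain t where t: "total a = int p * t"
    using p_dvd_total[OF assms] by (elim dvdE)
  have blk: "\<exists>r\<in>R. block a s u = of_nat p * r" for s u
  proof -
    obtain r where r: "r \<in> R" "block a s u = of_int (total a) + of_nat p * r"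
      using block_cong by blast
    then have "block a s u = of_nat p * (of_int t + r)"
      by (simp add: t distrib_left)
    then show ?thesis
      by (rule bexI) (intro R_intros r)
  qed
  obtain q where q: "q \<in> R" "of_nat p = \<pi>\<^sup>2 * q"
    using p_pi2 by blast
  define \<alpha> where "\<alpha> = (\<Sum>(i, j, l)\<in>triples. a i j l * int i)"
  define \<beta> where "\<beta> = (\<Sum>(i, j, l)\<in>triples. a i j l * int j)"
  have fv: "\<exists>r\<in>R. fval a u v = of_int (int u * \<alpha> + int v * \<beta>) * \<pi> + \<pi>\<^sup>2 * r" for u v
  proof -
    obtain r where r: "r \<in> R" "fval a u v = of_int (total a) + of_int (int u * \<alpha> + int v * \<beta>) * \<pi> + \<pi>\<^sup>2 * r"
      using fval_expand[of a u v] unfolding \<alpha>_def \<beta>_def by blast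
    \<comment> \<open>The constant term p * t is absorbed into the \<pi>^2 part, since p = \<pi>^2 *
      q.\<close>
    then have "fval a u v = of_int (int u * \<alpha> + int v * \<beta>) * \<pi> + \<pi>\<^sup>2 * (q * of_int t + r)"
      by (simp add: t q algebra_simps)
    then show ?thesis
      by (rule bexI) (intro R_intros r q)
  qed
  define S where "S = {..<p} \<times> {..<p} - {(0::nat, 0::nat)}"
  define Z where "Z = {(u, v). u < p \<and> v < p \<and> (u, v) \<noteq> (0, 0) \<and> int p dvd int u * \<alpha> + int v * \<beta>}"
  have fin: "finite S" and ZS: "Z \<subseteq> S"
    by (auto simp: S_def Z_def)
  have finZ: "finite Z"
    using fin ZS finite_subset by blast
  have "\<exists>r\<in>R. (\<Prod>(u, v)\<in>Z. fval a u v) = (\<pi>\<^sup>2) ^ card Z * r"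
  proof (rule prod_divisible[OF finZ], clarify)
    fix u v assume "(u, v) \<in> Z"
    then obtain k where k: "int u * \<alpha> + int v * \<beta> = int p * k"
      by (auto simp: Z_def elim: dvdE)
    obtain r where r: "r \<in> R" "fval a u v = of_int (int u * \<alpha> + int v * \<beta>) * \<pi> + \<pi>\<^sup>2 * r"
      using fv by blast
    have "fval a u v = \<pi>\<^sup>2 * (q * of_int k * \<pi> + r)"
      unfolding r(2) k by (simp add: q algebra_simps)
    then show "\<exists>r\<in>R. fval a u v = \<pi>\<^sup>2 * r"
      by (rule bexI) (intro R_intros r q R_pi)
  qed
  then obtain r1 where r1: "r1 \<in> R" "(\<Prod>(u, v)\<in>Z. fval a u v) = (\<pi>\<^sup>2) ^ card Z * r1"
    by blast
  have "\<exists>r\<in>R. (\<Prod>(u, v)\<in>S - Z. fval a u v) = \<pi> ^ card (S - Z) * r"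
  proof (rule prod_divisible, use fin in simp, clarify)
    fix u v
    obtain r where r: "r \<in> R" "fval a u v = of_int (int u * \<alpha> + int v * \<beta>) * \<pi> + \<pi>\<^sup>2 * r"
      using fv by blast
    have "fval a u v = \<pi> * (of_int (int u * \<alpha> + int v * \<beta>) + \<pi> * r)"
      unfolding r(2) by (simp add: algebra_simps power2_eq_square)
    then show "\<exists>r\<in>R. fval a u v = \<pi> * r"
      by (rule bexI) (intro R_intros r R_pi)
  qed
  then obtain r2 where r2: "r2 \<in> R" "(\<Prod>(u, v)\<in>S - Z. fval a u v) = \<pi> ^ card (S - Z) * r2"
    by blast
  have "\<exists>r\<in>R. (\<Prod>(s, u)\<in>{1..<p} \<times> {..<p}. block a s u) = of_nat p ^ card ({1..<p} \<times> {..<p}) * r"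
    by (rule prod_divisible) (use blk in auto)
  then obtain r3 where r3: "r3 \<in> R" "(\<Prod>(s, u)\<in>{1..<p} \<times> {..<p}. block a s u) = of_nat p ^ ((p - 1) * p) * r3"
    by auto
  \<comment> \<open>\<open>card_linear_solutions\<close> is only a lower bound; the surplus e
    survives as a harmless factor \<pi>^e.\<close>
  define e where "e = card Z - (p - 1)"
  have cardZ: "card Z = e + (p - 1)"
    using card_linear_solutions[of \<alpha> \<beta>] by (simp add: e_def Z_def)
  have "card S = p\<^sup>2 - 1"
    using p_pos by (simp add: S_def power2_eq_square)
  then have "2 * card Z + card (S - Z) = (p - 1) * (p + 2) + e"
    using card_Diff_subset[OF finZ ZS] card_mono[OF fin ZS] cardZ p_sq(1) p3 by linarith
  moreover obtain r4 where r4: "r4 \<in> R" "\<pi> ^ ((p - 1) * (p + 2)) = of_nat p ^ (p + 2) * r4"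
    using pi_power_mult by blast
  ultimately have "(\<pi>\<^sup>2) ^ card Z * \<pi> ^ card (S - Z) = of_nat p ^ (p + 2) * r4 * \<pi> ^ e"
    by (simp only: power_mult[symmetric] power_add[symmetric]) (simp only: power_add)
  moreover have "(\<Prod>(u, v)\<in>S. fval a u v) = (\<pi>\<^sup>2) ^ card Z * \<pi> ^ card (S - Z) * (r1 * r2)"
    using r1(2) r2(2) by (simp add: prod.subset_diff[OF ZS fin])
  ultimately have S: "(\<Prod>(u, v)\<in>S. fval a u v) = of_nat p ^ (p + 2) * (r4 * \<pi> ^ e * (r1 * r2))"
    by (simp only: mult.assoc)
  have "of_int (heis_det p a) = of_nat p * of_int t * (of_nat p ^ (p + 2) * (r4 * \<pi> ^ e * (r1 * r2))) *
      (of_nat p ^ ((p - 1) * p) * r3)"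
    unfolding heis_det_factors S_def[symmetric] S r3(2) t by simp
  also have "\<dots> = of_int (int p ^ (p\<^sup>2 + 3)) * (of_int t * (r4 * \<pi> ^ e * (r1 * r2)) * r3)"
    unfolding p_sq(2) by (simp add: power_add mult_ac)
  finally show ?thesis
    by (rule R_dvd_int) (intro R_intros r1 r2 r3 r4 R_pi)
qed

subsection \<open>Sharpness\<close>

text \<open>Exact \<pi>-adic order m(p-1) + e without a valuation: the cofactor has the residue k,
  nonzero modulo \<pi>. Powers of p and \<pi> are counted separately until
  \<open>has_ord_convert\<close> merges them.\<close>

definition has_ord :: "nat \<Rightarrow> nat \<Rightarrow> complex \<Rightarrow> bool" where
  "has_ord m e x \<longleftrightarrow> (\<exists>k r. r \<in> R \<and> \<not> int p dvd k \<and> x = of_nat p ^ m * \<pi> ^ e * (of_int k + \<pi> * r))"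

lemma prime_int_p: "prime (int p)"
  using prime_p by simp

lemma has_ord_I:
  "r \<in> R \<Longrightarrow> \<not> int p dvd k \<Longrightarrow> x = of_nat p ^ m * \<pi> ^ e * (of_int k + \<pi> * r) \<Longrightarrow> has_ord m e x"
  unfolding has_ord_def by blast

lemma has_ord_mult:
  assumes "has_ord m e x" "has_ord n f y"
  shows "has_ord (m + n) (e + f) (x * y)"
proof -
  obtain k r where k: "r \<in> R" "\<not> int p dvd k" "x = of_nat p ^ m * \<pi> ^ e * (of_int k + \<pi> * r)"
    using assms(1) by (auto simp: has_ord_def)
  obtain l q where l: "q \<in> R" "\<not> int p dvd l" "y = of_nat p ^ n * \<pi> ^ f * (of_int l + \<pi> * q)"
    using assms(2) by (auto simp: has_ord_def)
  show ?thesis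
  proof (rule has_ord_I)
    show "of_int k * q + r * of_int l + \<pi> * (r * q) \<in> R"
      by (intro R_intros R_pi k l)
    show "\<not> int p dvd k * l"
      using k l by (simp add: prime_dvd_mult_iff[OF prime_int_p])
    show "x * y = of_nat p ^ (m + n) * \<pi> ^ (e + f) *
        (of_int (k * l) + \<pi> * (of_int k * q + r * of_int l + \<pi> * (r * q)))"
      unfolding k(3) l(3) by (simp add: power_add algebra_simps)
  qed
qed

lemma has_ord_1: "has_ord 0 0 1"
  by (rule has_ord_I[of 0 1]) (use p3 in \<open>auto intro: R_0\<close>)

lemma has_ord_prod:
  assumes "finite A" "\<And>x. x \<in> A \<Longrightarrow> has_ord (m x) (e x) (f x)"
  shows "has_ord (\<Sum>x\<in>A. m x) (\<Sum>x\<in>A. e x) (\<Prod>x\<in>A. f x)"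
  using assms by (induction A rule: finite_induct) (auto intro: has_ord_1 has_ord_mult)

text \<open>By \<open>pi_power\<close>, each \<pi>^(p-1) is p times an element with residue -1
  modulo \<pi>.\<close>

lemma has_ord_convert:
  assumes "has_ord m ((p - 1) * n) x"
  shows "has_ord (m + n) 0 x"
proof -
  have "has_ord 1 0 (\<pi> ^ (p - 1))"
  proof (rule has_ord_I)
    show "- \<theta> \<in> R" by (intro R_intros R_theta)
    show "\<not> int p dvd - 1" using p3 by simp
    show "\<pi> ^ (p - 1) = of_nat p ^ 1 * \<pi> ^ 0 * (of_int (- 1) + \<pi> * - \<theta>)"
      unfolding pi_power by (simp add: algebra_simps)
  qed
  then have "has_ord (\<Sum>i<n. 1) (\<Sum>i<n. 0) (\<Prod>i<n. \<pi> ^ (p - 1))"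
    by (intro has_ord_prod) auto
  then have pn: "has_ord n 0 (\<pi> ^ ((p - 1) * n))"
    by (simp add: power_mult)
  obtain k r where k: "r \<in> R" "\<not> int p dvd k" "x = of_nat p ^ m * \<pi> ^ ((p - 1) * n) * (of_int k + \<pi> * r)"
    using assms by (auto simp: has_ord_def)
  have "has_ord m 0 (of_nat p ^ m * (of_int k + \<pi> * r))"
    by (rule has_ord_I[OF k(1,2)]) simp
  from has_ord_mult[OF this pn] show ?thesis
    by (simp add: k(3) mult_ac)
qed

text \<open>One more factor p would make \<pi> divide k, and then p divides k by
  \<open>pi_dvd_int\<close>.\<close>

lemma exactly_divides_if_has_ord:
  assumes "has_ord m 0 (of_int M)"
  shows "exactly_divides (int p) m M"
proof -
  obtain k r where k: "r \<in> R" "\<not> int p dvd k" "of_int M = of_nat p ^ m * (of_int k + \<pi> * r)"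
    using assms by (auto simp: has_ord_def)
  have "int p ^ m dvd M"
  proof (rule R_dvd_int)
    show "of_int M = of_int (int p ^ m) * (of_int k + \<pi> * r)"
      using k(3) by simp
  qed (intro R_intros R_pi k)
  moreover have "\<not> int p ^ (m + 1) dvd M"
  proof
    assume "int p ^ (m + 1) dvd M"
    then obtain n where n: "M = int p ^ (m + 1) * n"
      by (elim dvdE)
    have "of_nat p ^ m * (of_int k + \<pi> * r) = of_nat p ^ m * (of_nat p * of_int n)"
      unfolding k(3)[symmetric] by (simp add: n)
    then have *: "of_int k + \<pi> * r = of_nat p * of_int n"
      using p_pos by simp
    obtain q where q: "q \<in> R" "of_nat p = \<pi> * q"
      using p_pi by blast
    have "of_int k = \<pi> * (q * of_int n - r)"
      using * q(2) by (simp add: algebra_simps)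
    then have "int p dvd k"
      by (rule pi_dvd_int) (intro R_intros q k)
    then show False
      using k(2) by simp
  qed
  ultimately show ?thesis
    by (simp add: exactly_divides_def)
qed

text \<open>Each power of w is 1 modulo \<pi>, so the sum of the coefficients represents x.\<close>

lemma R_mod_pi:
  assumes "x \<in> R"
  shows "\<exists>n. \<exists>r\<in>R. x = of_int n + \<pi> * r"
proof -
  obtain c :: "nat \<Rightarrow> int" where x: "x = (\<Sum>i<p. of_int (c i) * w ^ i)"
    using assms by (auto simp: R_def)
  have "\<exists>r\<in>R. w ^ i = 1 + \<pi> * r" for i
  proof -
    obtain q where q: "q \<in> R" "w ^ i = 1 + of_nat i * \<pi> + \<pi>\<^sup>2 * q"
      using w_pow_pi by blast
    have "w ^ i = 1 + \<pi> * (of_nat i + \<pi> * q)"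
      unfolding q(2) by (simp add: algebra_simps power2_eq_square)
    then show ?thesis
      by (rule bexI) (intro R_intros q R_pi)
  qed
  then obtain r where r: "\<And>i. r i \<in> R \<and> w ^ i = 1 + \<pi> * r i"
    by metis
  have "x = of_int (\<Sum>i<p. c i) + \<pi> * (\<Sum>i<p. of_int (c i) * r i)"
    unfolding x using r by (simp add: sum.distrib[symmetric] sum_distrib_left algebra_simps)
  moreover have "(\<Sum>i<p. of_int (c i) * r i) \<in> R"
    using r by (intro R_sum R_mult R_int) blast
  ultimately show ?thesis
    by blast
qed

text \<open>Only the constant choices of one of the two entries in each row give a nonzero determinant.\<close>

lemma ldet_bidiagonal:
  "ldet [0..<p] (\<lambda>v v'. (if (v + 1) mod p = v' then 1 else 0) - (if v = v' then d v else 0)) =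
    1 - (\<Prod>v<p. d v)" for d :: "nat \<Rightarrow> complex"
proof -
  \<comment> \<open>Choice 0 selects the diagonal entry of a row, choice 1 its cyclic right
    neighbour.\<close>
  define c where "c v e = (if e = (0::nat) then - d v else 1)" for v e
  define L where "L G = ldet [0..<p] (\<lambda>v v'. if (v + G v) mod p = v' then 1 else 0 :: complex)"
    for G :: "nat \<Rightarrow> nat"
  define C where "C e = restrict (\<lambda>_. e) {..<p}" for e :: nat
  define F where "F = {..<p} \<rightarrow>\<^sub>E {0::nat, 1}"
  have L_const: "L (C e) = 1" for e
  proof -
    have "L (C e) = ldet [0..<p] (\<lambda>v v'. of_int (if (v + e) mod p = v' then 1 else 0))"
      unfolding L_def by (rule ldet_cong) (auto simp: C_def)
    also have "\<dots> = of_int (cshift e)"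
      unfolding ldet_of_int cshift_def ..
    finally show ?thesis
      by (simp add: cshift_eq_1)
  qed
  have L_0: "L G = 0" if G: "G \<in> F" "G \<noteq> C 0" "G \<noteq> C 1" for G
  proof -
    have val: "G v = 0 \<or> G v = 1" if "v < p" for v
      using G(1) that by (auto simp: F_def)
    have neq: "\<exists>v<p. G v \<noteq> e" if "G \<noteq> C e" for e
    proof (rule ccontr)
      assume *: "\<not> (\<exists>v<p. G v \<noteq> e)"
      have "G v = C e v" for v
        using * G(1) by (cases "v < p") (auto simp: C_def F_def PiE_iff extensional_def)
      then show False
        using that by auto
    qed
    \<comment> \<open>Going round the cycle, a nonconstant choice drops somewhere from 1 to 0. Rows
      v and v + 1 then both have their only 1 in column v + 1.\<close>
    have "\<exists>v<p. G v = 1 \<and> G ((v + 1) mod p) = 0"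
    proof (rule ccontr)
      assume *: "\<not> ?thesis"
      obtain x where x0: "x < p" "G x \<noteq> 0"
        using neq[OF G(2)] by blast
      then have x: "x < p" "G x = 1"
        using val[of x] by simp_all
      have step: "G ((v + 1) mod p) = 1" if "v < p" "G v = 1" for v
      proof -
        have "G ((v + 1) mod p) \<noteq> 0"
        proof
          assume "G ((v + 1) mod p) = 0"
          then have "\<exists>v<p. G v = 1 \<and> G ((v + 1) mod p) = 0"
            using that by (intro exI[of _ v] conjI)
          then show False
            using * by (rule notE[rotated])
        qed
        then show ?thesis
          using val[OF mod_less_divisor[OF p_pos], of "v + 1"] by argo
      qed
      have all: "G ((x + k) mod p) = 1" for k
      proof (induction k)
        case (Suc k)
        have "((x + k) mod p + 1) mod p = (x + Suc k) mod p"
          using mod_add_left_eq[of "x + k" p 1] by simp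
        then show ?case
          using step[OF mod_less_divisor[OF p_pos] Suc] by (rule subst)
      qed (use x in simp)
      obtain y where y: "y < p" "G y \<noteq> 1"
        using neq[OF G(3)] by blast
      have "(x + (y + (p - x))) mod p = y"
        using x y by simp
      then show False
        using all[of "y + (p - x)"] y by simp
    qed
    then obtain v where v: "v < p" "G v = 1" "G ((v + 1) mod p) = 0"
      by blast
    have "(v + 1) mod p \<noteq> v"
      using v(1) p3 by (cases "v + 1 = p") auto
    then show ?thesis
      unfolding L_def
      by (intro ldet_equal_rows[of v p "(v + 1) mod p"]) (use v p_pos in auto)
  qed
  have "ldet [0..<p] (\<lambda>v v'. (if (v + 1) mod p = v' then 1 else 0) - (if v = v' then d v else 0)) =
      ldet [0..<p] (\<lambda>v v'. \<Sum>e\<in>{0, 1}. c v e * (if (v + e) mod p = v' then 1 else 0))"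
    by (rule ldet_cong) (auto simp: c_def)
  also have "\<dots> = (\<Sum>G\<in>F. (\<Prod>v<p. c v (G v)) * L G)"
    unfolding L_def F_def by (rule ldet_row_sums) simp
  also have "\<dots> = (\<Sum>G\<in>{C 0, C 1}. (\<Prod>v<p. c v (G v)) * L G)"
  proof (rule sum.mono_neutral_right)
    show "finite F" unfolding F_def by (intro finite_PiE) auto
    show "{C 0, C 1} \<subseteq> F" by (auto simp: F_def C_def)
    show "\<forall>G\<in>F - {C 0, C 1}. (\<Prod>v<p. c v (G v)) * L G = 0"
      using L_0 by auto
  qed
  also have "\<dots> = (\<Prod>v<p. - d v) + 1"
  proof -
    have "C 0 \<noteq> C 1"
      using p_pos by (auto simp: C_def fun_eq_iff)
    moreover have "(\<Prod>v<p. c v (C e v)) = (\<Prod>v<p. c v e)" for e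
      by (rule prod.cong) (simp_all add: C_def)
    ultimately show ?thesis
      by (simp add: L_const) (simp add: c_def)
  qed
  also have "(\<Prod>v<p. - d v) = - (\<Prod>v<p. d v)"
  proof -
    have "(\<Prod>v<p. - d v) = (\<Prod>v<p. - 1 * d v)"
      by simp
    also have "\<dots> = (- 1) ^ p * (\<Prod>v<p. d v)"
      unfolding prod.distrib by simp
    finally show ?thesis
      using odd_p by simp
  qed
  finally show ?thesis
    by simp
qed

section \<open>The witness y - h(x)\<close>

lemma sum_triples_0: "(\<Sum>(i, j, l)\<in>triples. if l = 0 then g i j else 0) = (\<Sum>i<p. \<Sum>j<p. g i j)"
  for g :: "nat \<Rightarrow> nat \<Rightarrow> complex"
  unfolding triples_def sum.cartesian_product' using p_pos by (simp add: sum.delta)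

text \<open>Coefficients of 1 + (x-1)^2 = 2 - 2x + x^2.\<close>

definition quad :: "nat \<Rightarrow> int" where
  "quad i = (if i = 0 then 2 else if i = 1 then - 2 else if i = 2 then 1 else 0)"

lemma sum_quad: "(\<Sum>i<p. of_int (quad i) * g i) = 2 * g 0 - 2 * g 1 + g 2" for g :: "nat \<Rightarrow> complex"
proof -
  have "(\<Sum>i<p. of_int (quad i) * g i) = (\<Sum>i\<in>{0, 1, 2}. of_int (quad i) * g i)"
    by (rule sum.mono_neutral_right) (use p3 in \<open>auto simp: quad_def\<close>)
  then show ?thesis
    by (simp add: quad_def)
qed

definition witness :: "int \<Rightarrow> nat \<Rightarrow> nat \<Rightarrow> nat \<Rightarrow> int" where
  "witness t i j l = (if l = 0 then (if j = 1 \<and> i = 0 then 1 else 0) - (if j = 0 then quad i + t else 0) else 0)"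

text \<open>The value h(w^m): the geometric sum multiplied by t survives only at w^m = 1, where it
  is p.\<close>

definition hval :: "int \<Rightarrow> nat \<Rightarrow> complex" where
  "hval t m = 1 + (w ^ m - 1)\<^sup>2 + (if p dvd m then of_int t * of_nat p else 0)"

lemma hval_sum: "(\<Sum>i<p. of_int (quad i + t) * w ^ (m * i)) = hval t m"
proof -
  have "(\<Sum>i<p. of_int (quad i + t) * w ^ (m * i)) =
      (\<Sum>i<p. of_int (quad i) * w ^ (m * i)) + of_int t * (\<Sum>i<p. w ^ (m * i))"
    by (simp add: sum.distrib distrib_right sum_distrib_left)
  also have "\<dots> = 2 - 2 * w ^ m + w ^ (m * 2) + of_int t * (if p dvd m then of_nat p else 0)"
    unfolding sum_quad sum_w_pow by simp
  also have "w ^ (m * 2) = (w ^ m)\<^sup>2"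
    by (simp add: power_mult)
  finally show ?thesis
    by (simp add: hval_def power2_eq_square algebra_simps)
qed

lemma witness_sum:
  "(\<Sum>(i, j, l)\<in>triples. of_int (witness t i j l) * g i j l) =
    g 0 1 0 - (\<Sum>i<p. of_int (quad i + t) * g i 0 0)" for g :: "nat \<Rightarrow> nat \<Rightarrow> nat \<Rightarrow> complex"
proof -
  have "(\<Sum>(i, j, l)\<in>triples. of_int (witness t i j l) * g i j l) =
      (\<Sum>(i, j, l)\<in>triples. if l = 0 then (if j = 1 then if i = 0 then g i j 0 else 0 else 0) -
         (if j = 0 then of_int (quad i + t) * g i j 0 else 0) else 0)"
    by (intro sum.cong) (auto simp: witness_def left_diff_distrib)
  also have "\<dots> = (\<Sum>i<p. \<Sum>j<p. (if j = 1 then if i = 0 then g i j 0 else 0 else 0) -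
      (if j = 0 then of_int (quad i + t) * g i j 0 else 0))"
    by (rule sum_triples_0)
  also have "\<dots> = (\<Sum>i<p. (if i = 0 then g i 1 0 else 0) - of_int (quad i + t) * g i 0 0)"
    using p3 by (simp add: sum_subtractf sum.delta)
  also have "\<dots> = g 0 1 0 - (\<Sum>i<p. of_int (quad i + t) * g i 0 0)"
    using p_pos by (simp add: sum_subtractf sum.delta)
  finally show ?thesis .
qed

lemma fval_witness: "fval (witness t) u v = w ^ v - hval t u"
  unfolding fval_def witness_sum by (simp add: hval_sum del: of_int_add)

text \<open>Here y acts as the cyclic shift and h(x) diagonally, so \<open>ldet_bidiagonal\<close>
  applies.\<close>

lemma block_witness: "block (witness t) s u = 1 - (\<Prod>v<p. hval t (u + s * v))"
proof -
  have "block (witness t) s u =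
      ldet [0..<p] (\<lambda>v v'. (if (v + 1) mod p = v' then 1 else 0) - (if v = v' then hval t (u + s * v) else 0))"
    unfolding block_def
  proof (rule ldet_cong, rule refl)
    fix v v' assume v: "v \<in> set [0..<p]" "v' \<in> set [0..<p]"
    define g :: "nat \<Rightarrow> nat \<Rightarrow> nat \<Rightarrow> complex" where
      "g i j l = w ^ (s * l + (u + s * v) * i) * (if (v + j) mod p = v' then 1 else 0)" for i j l
    have "(\<Sum>k\<in>triples. coef (witness t) s u v k * (if (v + fst (snd k)) mod p = v' then 1 else 0)) =
        (\<Sum>(i, j, l)\<in>triples. of_int (witness t i j l) * g i j l)"
      by (rule sum.cong) (auto simp: coef_def g_def)
    also have "\<dots> = g 0 1 0 - (\<Sum>i<p. of_int (quad i + t) * g i 0 0)"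
      by (rule witness_sum)
    also have "(\<Sum>i<p. of_int (quad i + t) * g i 0 0) = (if v = v' then hval t (u + s * v) else 0)"
      using v by (simp add: g_def hval_sum del: of_int_add)
    also have "g 0 1 0 = (if (v + 1) mod p = v' then 1 else 0)"
      by (simp add: g_def)
    finally show "(\<Sum>k\<in>triples. coef (witness t) s u v k * (if (v + fst (snd k)) mod p = v' then 1 else 0)) =
        (if (v + 1) mod p = v' then 1 else 0) - (if v = v' then hval t (u + s * v) else 0)" .
  qed
  then show ?thesis
    by (simp only: ldet_bidiagonal)
qed

lemma hval_mod: "hval t (m mod p) = hval t m"
  by (simp add: hval_def w_mod dvd_mod_iff)

text \<open>As s is invertible modulo p, u + s * v runs through all residues, and only the residue 0
  contributes a factor that depends on t.\<close>

lemma prod_hval: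
  assumes "0 < s" "s < p"
  shows "(\<Prod>v<p. hval t (u + s * v)) = (1 + of_int t * of_nat p) * (\<Prod>i\<in>{1..<p}. hval 0 i)"
proof -
  have "inj_on (\<lambda>v. (u + s * v) mod p) {..<p}"
  proof (rule inj_onI)
    fix v v' assume v: "v \<in> {..<p}" "v' \<in> {..<p}" "(u + s * v) mod p = (u + s * v') mod p"
    then have "[s * v = s * v'] (mod p)"
      by (simp add: cong_def[symmetric] cong_add_lcancel_nat)
    moreover have "coprime s p"
      using assms by (intro coprime_p) (auto dest: dvd_imp_le)
    ultimately have "[v = v'] (mod p)"
      using cong_mult_lcancel_nat by blast
    then show "v = v'"
      using v by (simp add: cong_def)
  qed
  moreover from this have "(\<lambda>v. (u + s * v) mod p) ` {..<p} = {..<p}"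
    using p_pos by (intro endo_inj_surj) auto
  ultimately have bij: "bij_betw (\<lambda>v. (u + s * v) mod p) {..<p} {..<p}"
    by (simp add: bij_betw_def)
  have "(\<Prod>v<p. hval t (u + s * v)) = (\<Prod>v<p. hval t ((u + s * v) mod p))"
    by (simp add: hval_mod)
  also have "\<dots> = (\<Prod>i<p. hval t i)"
    by (rule prod.reindex_bij_betw[OF bij])
  also have "\<dots> = hval t 0 * (\<Prod>i\<in>{1..<p}. hval t i)"
    by (rule prod_split_0)
  also have "(\<Prod>i\<in>{1..<p}. hval t i) = (\<Prod>i\<in>{1..<p}. hval 0 i)"
    by (rule prod.cong) (auto simp: hval_def dest: dvd_imp_le)
  finally show ?thesis
    by (simp add: hval_def)
qed

text \<open>For t = 0 the value F(1,1,1) vanishes, so \<open>block_cong\<close> makes 1 minus the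
  product divisible by p without computing the product. \<open>R_mod_pi\<close> extracts the residue
  n of the quotient.\<close>

lemma prod_hval_0: "\<exists>n. \<exists>r\<in>R. (\<Prod>i\<in>{1..<p}. hval 0 i) = 1 + of_nat p * (of_int n + \<pi> * r)"
proof -
  obtain q where q: "q \<in> R" "block (witness 0) 1 0 = of_int (total (witness 0)) + of_nat p * q"
    using block_cong by blast
  have "(of_int (total (witness 0)) :: complex) = fval (witness 0) 0 0"
    by (simp add: fval_def total_def case_prod_unfold)
  then have "of_int (total (witness 0)) = (0 :: complex)"
    by (simp add: fval_witness hval_def)
  moreover have "(\<Prod>v<p. hval 0 (0 + 1 * v)) = (1 + of_int 0 * of_nat p) * (\<Prod>i\<in>{1..<p}. hval 0 i)"
    by (rule prod_hval) (use p3 in auto)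
  ultimately have "(\<Prod>i\<in>{1..<p}. hval 0 i) = 1 + of_nat p * (- q)"
    using q(2) unfolding block_witness by (simp add: algebra_simps)
  then show ?thesis
    using R_mod_pi[OF R_uminus[OF q(1)]] by metis
qed

lemma exists_sharp: "\<exists>a. exactly_divides (int p) (p\<^sup>2 + 3) (heis_det p a)"
proof -
  obtain n r where n: "r \<in> R" "(\<Prod>i\<in>{1..<p}. hval 0 i) = 1 + of_nat p * (of_int n + \<pi> * r)"
    using prod_hval_0 by blast
  \<comment> \<open>Divided by p, \<open>total\<close> becomes -t and each block with s > 0 becomes
    -(t + n) modulo \<pi>. If t = 1 fails because p divides 1 + n, then 2 + n is 1 modulo p and t =
    2 works.\<close>
  obtain t :: int where t: "\<not> int p dvd t" "\<not> int p dvd t + n"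
  proof (cases "int p dvd 1 + n")
    case True
    have "\<not> int p dvd 2"
      using p3 by (auto dest: zdvd_imp_le)
    moreover have "\<not> int p dvd 2 + n"
      using dvd_diff[of "int p" "2 + n" "1 + n"] True p3 by auto
    ultimately show ?thesis
      using that by blast
  next
    case False
    then show ?thesis
      using that[of 1] p3 by simp
  qed
  let ?a = "witness t"
  obtain q where q: "q \<in> R" "of_nat p = \<pi> * q"
    using p_pi by blast
  obtain q2 where q2: "q2 \<in> R" "of_nat p = \<pi>\<^sup>2 * q2"
    using p_pi2 by blast
  have total: "has_ord 1 0 (of_int (total ?a))"
  proof -
    have "(of_int (total ?a) :: complex) = fval ?a 0 0"
      by (simp add: fval_def total_def case_prod_unfold)
    also have "\<dots> = of_nat p ^ 1 * \<pi> ^ 0 * (of_int (- t) + \<pi> * 0)"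
      by (simp add: fval_witness hval_def)
    finally show ?thesis
      by (rule has_ord_I[OF R_0, rotated]) (use t in simp)
  qed
  have blocks: "has_ord 1 0 (block ?a s u)" if s: "s \<in> {1..<p}" for s u
  proof (rule has_ord_I)
    show "- (r + of_int t * q * (of_int n + \<pi> * r)) \<in> R"
      by (intro R_intros n q R_pi)
    show "\<not> int p dvd - (t + n)"
      using t by (simp only: dvd_minus_iff) simp
    have "block ?a s u = 1 - (1 + of_int t * of_nat p) * (1 + of_nat p * (of_int n + \<pi> * r))"
      using s unfolding block_witness n(2)[symmetric] by (subst prod_hval) auto
    also have "\<dots> = - of_nat p * (of_int (t + n) + \<pi> * r + of_int t * of_nat p * (of_int n + \<pi> * r))"
      by (simp add: algebra_simps)
    also have "of_int t * of_nat p * (of_int n + \<pi> * r) = \<pi> * (of_int t * q * (of_int n + \<pi> * r))"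
      unfolding q(2) by (simp add: mult_ac)
    finally show "block ?a s u = of_nat p ^ 1 * \<pi> ^ 0 *
        (of_int (- (t + n)) + \<pi> * - (r + of_int t * q * (of_int n + \<pi> * r)))"
      by (simp add: algebra_simps)
  qed
  \<comment> \<open>The value w^v - h(w^u) is v * \<pi> modulo \<pi>^2, and for v = 0 its leading
    term is -u^2 * \<pi>^2. So exactly p - 1 values have order 2, the fewest possible.\<close>
  have fvals: "has_ord 0 (if v = 0 then 2 else 1) (fval ?a u v)"
    if uv: "u < p" "v < p" "(u, v) \<noteq> (0, 0)" for u v
  proof -
    have nd: "\<not> int p dvd int m" if "0 < m" "m < p" for m
      using that by (auto simp: int_dvd_int_iff dest: dvd_imp_le)
    obtain ru where ru: "ru \<in> R" "w ^ u = 1 + of_nat u * \<pi> + \<pi>\<^sup>2 * ru"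
      using w_pow_pi by blast
    obtain rv where rv: "rv \<in> R" "w ^ v = 1 + of_nat v * \<pi> + \<pi>\<^sup>2 * rv"
      using w_pow_pi by blast
    have wu: "(w ^ u - 1)\<^sup>2 = \<pi>\<^sup>2 * (of_nat u + \<pi> * ru)\<^sup>2"
      unfolding ru(2) by (simp add: power2_eq_square algebra_simps)
    show ?thesis
    proof (cases "v = 0")
      case True
      then have u: "0 < u"
        using uv by auto
      then have "\<not> p dvd u"
        using uv by (auto dest: dvd_imp_le)
      then have "fval ?a u v = - (\<pi>\<^sup>2 * (of_nat u + \<pi> * ru)\<^sup>2)"
        unfolding fval_witness hval_def wu using True by simp
      also have "\<dots> = of_nat p ^ 0 * \<pi> ^ 2 * (of_int (- (int u)\<^sup>2) + \<pi> * (- (2 * of_nat u * ru + \<pi> * ru\<^sup>2)))"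
        by (simp add: power2_eq_square algebra_simps)
      finally have eq: "fval ?a u v = of_nat p ^ 0 * \<pi> ^ 2 * (of_int (- (int u)\<^sup>2) + \<pi> * (- (2 * of_nat u * ru + \<pi> * ru\<^sup>2)))" .
      have "- (2 * of_nat u * ru + \<pi> * ru\<^sup>2) \<in> R"
        using R_int[of 2] by (intro R_intros ru R_pi) simp
      moreover have "\<not> int p dvd - (int u)\<^sup>2"
        using nd[OF u uv(1)] by (simp add: power2_eq_square prime_dvd_mult_iff[OF prime_int_p])
      ultimately show ?thesis
        using has_ord_I[OF _ _ eq] True by simp
    next
      case False
      define \<delta> :: complex where "\<delta> = (if p dvd u then of_int t * q2 else 0)"
      have \<delta>: "\<delta> \<in> R"
        by (auto simp: \<delta>_def intro!: R_intros q2)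
      \<comment> \<open>At u = 0 the term t * p is a multiple of \<pi>^2 and does not disturb the
        order 1.\<close>
      have tp: "(if p dvd u then of_int t * of_nat p else 0) = \<pi>\<^sup>2 * \<delta>"
        by (simp add: \<delta>_def q2(2))
      have eq: "fval ?a u v = of_nat p ^ 0 * \<pi> ^ 1 *
          (of_int (int v) + \<pi> * (rv - (of_nat u + \<pi> * ru)\<^sup>2 - \<delta>))"
        unfolding fval_witness hval_def wu tp rv(2) by (simp add: power2_eq_square algebra_simps)
      have "rv - (of_nat u + \<pi> * ru)\<^sup>2 - \<delta> \<in> R"
        by (intro R_intros rv ru R_pi \<delta>)
      then show ?thesis
        using has_ord_I[OF _ nd eq] False uv by simp
    qed
  qed
  let ?S = "{..<p} \<times> {..<p} - {(0::nat, 0::nat)}"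
  have "has_ord (\<Sum>z\<in>?S. 0) (\<Sum>(u, v)\<in>?S. if v = 0 then 2 else 1) (\<Prod>(u, v)\<in>?S. fval ?a u v)"
  proof (rule has_ord_prod)
    fix z assume z: "z \<in> ?S"
    then obtain u v where "z = (u, v)" "u < p" "v < p" "(u, v) \<noteq> (0, 0)"
      by (cases z) auto
    then show "has_ord 0 (case z of (u, v) \<Rightarrow> if v = 0 then 2 else 1) (case z of (u, v) \<Rightarrow> fval ?a u v)"
      using fvals by simp
  qed simp
  moreover have "(\<Sum>(u, v)\<in>?S. if v = 0 then 2 else 1) = (p - 1) * (p + 2)"
  proof -
    \<comment> \<open>Over the full square the orders add up to p^2 plus p for the line v = 0; the
      origin accounts for 2 of these.\<close>
    have "(\<Sum>(u, v)\<in>{..<p} \<times> {..<p}. if v = 0 then 2 else 1) = (\<Sum>u<p. \<Sum>v<p. 1 + (if v = 0 then 1 else 0 :: nat))"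
      unfolding sum.cartesian_product by (intro sum.cong) auto
    also have "\<dots> = p * (p + 1)"
      using p_pos by (simp only: sum.distrib) (simp add: sum.delta)
    also have "(\<Sum>(u, v)\<in>{..<p} \<times> {..<p}. if v = 0 then 2 else 1) = 2 + (\<Sum>(u, v)\<in>?S. if v = 0 then 2 else (1 :: nat))"
      using p_pos by (subst sum.remove[of _ "(0, 0)"]) auto
    finally show ?thesis
      using p_sq(1) by (simp add: power2_eq_square)
  qed
  ultimately have S: "has_ord 0 ((p - 1) * (p + 2)) (\<Prod>(u, v)\<in>?S. fval ?a u v)"
    by simp
  have "has_ord (\<Sum>z\<in>{1..<p} \<times> {..<p}. 1) (\<Sum>z\<in>{1..<p} \<times> {..<p}. 0) (\<Prod>(s, u)\<in>{1..<p} \<times> {..<p}. block ?a s u)"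
    by (intro has_ord_prod) (use blocks in auto)
  then have B: "has_ord ((p - 1) * p) 0 (\<Prod>(s, u)\<in>{1..<p} \<times> {..<p}. block ?a s u)"
    by simp
  have "has_ord (1 + (p - 1) * p) ((p - 1) * (p + 2)) (of_int (heis_det p ?a))"
    using has_ord_mult[OF has_ord_mult[OF total S] B] by (simp add: heis_det_factors)
  then have "has_ord (1 + (p - 1) * p + (p + 2)) 0 (of_int (heis_det p ?a))"
    by (rule has_ord_convert)
  moreover have "1 + (p - 1) * p + (p + 2) = p\<^sup>2 + 3"
    using p_sq(2) by simp
  ultimately show ?thesis
    using exactly_divides_if_has_ord by metis
qed

end

theorem theorem4:
  fixes p :: nat
  assumes "prime p" and "p \<ge> 3"
  shows "(\<forall>a :: nat \<Rightarrow> nat \<Rightarrow> nat \<Rightarrow> int.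
            int p dvd heis_det p a \<longrightarrow> int p ^ (p\<^sup>2 + 3) dvd heis_det p a)
       \<and> (\<exists>a :: nat \<Rightarrow> nat \<Rightarrow> nat \<Rightarrow> int.
            exactly_divides (int p) (p\<^sup>2 + 3) (heis_det p a))"
proof -
  interpret prime_root p "cis (2 * pi / p)"
  proof
    show "cis (2 * pi / real p) ^ p = 1"
      using assms by (simp add: DeMoivre)
    \<comment> \<open>As p >= 3, the angle lies strictly between 0 and \<open>pi\<close>; the
      positive imaginary part rules out the value 1.\<close>
    have "sin (2 * pi / p) > 0"
      using assms by (intro sin_gt_zero) (auto simp: field_simps)
    then show "cis (2 * pi / real p) \<noteq> 1"
      by (auto simp: complex_eq_iff)
  qed (use assms in auto)
  show ?thesis
    using heis_det_divisible exists_sharp by blast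
qed

end
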